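(* Let $(S,X_1,X_2,Y)$ be a discrete memoryless source on finite alphabets $\mathcal{S}\times\mathcal{X}_1\times\mathcal{X}_2\times\mathcal{Y}$ with joint pmf of the form $p(x_1,x_2,y)\,p(s|x_1)$ (so $S-X_1-(X_2,Y)$ is a Markov chain), and let $d_1,d_2,d_s$ be bounded per-letter distortion functions. The rate-distortion function $R(D_1,D_2,D_s)$ for compression and inference with side information (defined operationally in the context) is given as the solution to the following optimization problem: $$R(D_1,D_2,D_s)=\min I(X_1,X_2;\hat X_1,\hat X_2,\hat S\,|\,Y)$$ subject to $$\mathbb{E}\,d_1(X_1,\hat X_1)\le D_1,\qquad \mathbb{E}\,d_2(X_2,\hat X_2)\le D_2,\qquad \mathbb{E}\,d_s'(X_1,\hat S)\le D_s,$$ where the minimum is taken over all conditional pmfs $p(\hat x_1,\hat x_2,\hat s|x_1,x_2,y)$ and the modified distortion measure is defined by $$d_s'(x_1,\hat s)=\frac{1}{p(x_1)}\sum_{s\in\mathcal S}p(x_1,s)\,d_s(s,\hat s).$$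
   Context: Let $(S_i,X_{1,i},X_{2,i},Y_i)$, $i=1,2,\dots$, be i.i.d. copies of $(S,X_1,X_2,Y)$. Let $\hat{\mathcal X}_1,\hat{\mathcal X}_2,\hat{\mathcal S}$ be the reconstruction alphabets, in which $\hat X_1,\hat X_2,\hat S$ respectively take values, and let $d_1:\mathcal X_1\times\hat{\mathcal X}_1\to[0,\infty)$, $d_2:\mathcal X_2\times\hat{\mathcal X}_2\to[0,\infty)$, $d_s:\mathcal S\times\hat{\mathcal S}\to[0,\infty)$ be bounded. For sequences, $d_1(x_1^n,\hat x_1^n)=\frac1n\sum_{i=1}^n d_1(x_{1,i},\hat x_{1,i})$, and similarly for $d_2$ and $d_s$. An $(n,2^{nR})$ code consists of an encoding function $\mathcal X_1^n\times\mathcal X_2^n\times\mathcal Y^n\to\{1,2,\dots,2^{nR}\}$ and a decoding function $\{1,2,\dots,2^{nR}\}\times\mathcal Y^n\to\hat{\mathcal X}_1^n\times\hat{\mathcal X}_2^n\times\hat{\mathcal S}^n$. That is, the encoder sees $(X_1^n,X_2^n,Y^n)$ but not $S^n$, the side information $Y^n$ is available to both encoder and decoder, and the decoder outputs $(\hat X_1^n,\hat X_2^n,\hat S^n)$. A nonnegative tuple $(R,D_1,D_2,D_s)$ is achievable if for sufficiently large $n$ there exists an $(n,2^{nR})$ code such that $\lim_{n\to\infty}\mathbb E d_1(X_1^n,\hat X_1^n)\le D_1$, $\lim_{n\to\infty}\mathbb E d_2(X_2^n,\hat X_2^n)\le D_2$ and $\lim_{n\to\infty}\mathbb E d_s(S^n,\hat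 S^n)\le D_s$. The rate-distortion function $R(D_1,D_2,D_s)$ is the infimum of the coding rates $R$ such that $(R,D_1,D_2,D_s)$ is achievable. Logarithms (in mutual information) are base 2. In the minimization, $(X_1,X_2,Y)$ has the source distribution $p(x_1,x_2,y)$, and $p(x_1,s)$, $p(x_1)$ are the corresponding marginals of the source pmf. Symbols $x_1$ with $p(x_1)=0$ may be disregarded, and an infimum/minimum over an empty set is $+\infty$.
   Formalization: The reconstruction alphabets are taken to be finite, like the source alphabets; for infinite ones the claim can fail, e.g. d_1(x,k)=1/k on k=1,2,... with D_1=0, where the rate-distortion function is 0 but no conditional pmf meets the constraint. *)

theory Defs
  imports "HOL-Probability.Probability"
begin

text \<open>
  Source letters are tuples \<open>(s, x1, x2, y)\<close>; a source block of length \<open>n\<close> is a list distributed as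
  \<open>replicate_pmf n P\<close>, i.e. \<open>n\<close> i.i.d. copies of a letter with joint pmf \<open>P\<close>.
\<close>

definition src_S :: "'s \<times> 'x1 \<times> 'x2 \<times> 'y \<Rightarrow> 's" where
  "src_S = (\<lambda>(s, x1, x2, y). s)"

definition src_X1 :: "'s \<times> 'x1 \<times> 'x2 \<times> 'y \<Rightarrow> 'x1" where
  "src_X1 = (\<lambda>(s, x1, x2, y). x1)"

definition src_X2 :: "'s \<times> 'x1 \<times> 'x2 \<times> 'y \<Rightarrow> 'x2" where
  "src_X2 = (\<lambda>(s, x1, x2, y). x2)"

definition src_Y :: "'s \<times> 'x1 \<times> 'x2 \<times> 'y \<Rightarrow> 'y" where
  "src_Y = (\<lambda>(s, x1, x2, y). y)"

definition block_distortion :: "nat \<Rightarrow> ('a \<Rightarrow> 'b \<Rightarrow> real) \<Rightarrow> 'a list \<Rightarrow> 'b list \<Rightarrow> real" where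
  "block_distortion n d x xh = (1 / real n) * (\<Sum>i<n. d (x ! i) (xh ! i))"

definition seqs :: "nat \<Rightarrow> 'a list set" where
  "seqs n = {xs. length xs = n}"

text \<open>The index set \<open>{1, 2, \<dots>, 2\<^sup>n\<^sup>R}\<close>; when \<open>2\<^sup>n\<^sup>R\<close> is not an integer it stops at the floor.\<close>

definition messages :: "nat \<Rightarrow> real \<Rightarrow> nat set" where
  "messages n R = {m. 1 \<le> m \<and> real m \<le> 2 powr (real n * R)}"

type_synonym ('x1, 'x2, 'y) encoder = "'x1 list \<times> 'x2 list \<times> 'y list \<Rightarrow> nat"
type_synonym ('y, 'h1, 'h2, 'hs) decoder = "nat \<times> 'y list \<Rightarrow> 'h1 list \<times> 'h2 list \<times> 'hs list"

definition is_code ::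
  "nat \<Rightarrow> real \<Rightarrow> ('x1, 'x2, 'y) encoder \<Rightarrow> ('y, 'h1, 'h2, 'hs) decoder \<Rightarrow> bool" where
  "is_code n R enc dec \<longleftrightarrow>
     enc \<in> seqs n \<times> seqs n \<times> seqs n \<rightarrow> messages n R \<and>
     dec \<in> messages n R \<times> seqs n \<rightarrow> seqs n \<times> seqs n \<times> seqs n"

definition reconstruction ::
  "('x1, 'x2, 'y) encoder \<Rightarrow> ('y, 'h1, 'h2, 'hs) decoder \<Rightarrow> ('s \<times> 'x1 \<times> 'x2 \<times> 'y) list
    \<Rightarrow> 'h1 list \<times> 'h2 list \<times> 'hs list" where
  "reconstruction enc dec w =
     dec (enc (map src_X1 w, map src_X2 w, map src_Y w), map src_Y w)"

definition expected_d1 ::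
  "('s \<times> 'x1 \<times> 'x2 \<times> 'y) pmf \<Rightarrow> ('x1 \<Rightarrow> 'h1 \<Rightarrow> real) \<Rightarrow> nat
    \<Rightarrow> ('x1, 'x2, 'y) encoder \<Rightarrow> ('y, 'h1, 'h2, 'hs) decoder \<Rightarrow> real" where
  "expected_d1 P d1 n enc dec =
     measure_pmf.expectation (replicate_pmf n P)
       (\<lambda>w. block_distortion n d1 (map src_X1 w) (fst (reconstruction enc dec w)))"

definition expected_d2 ::
  "('s \<times> 'x1 \<times> 'x2 \<times> 'y) pmf \<Rightarrow> ('x2 \<Rightarrow> 'h2 \<Rightarrow> real) \<Rightarrow> nat
    \<Rightarrow> ('x1, 'x2, 'y) encoder \<Rightarrow> ('y, 'h1, 'h2, 'hs) decoder \<Rightarrow> real" where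
  "expected_d2 P d2 n enc dec =
     measure_pmf.expectation (replicate_pmf n P)
       (\<lambda>w. block_distortion n d2 (map src_X2 w) (fst (snd (reconstruction enc dec w))))"

definition expected_ds ::
  "('s \<times> 'x1 \<times> 'x2 \<times> 'y) pmf \<Rightarrow> ('s \<Rightarrow> 'hs \<Rightarrow> real) \<Rightarrow> nat
    \<Rightarrow> ('x1, 'x2, 'y) encoder \<Rightarrow> ('y, 'h1, 'h2, 'hs) decoder \<Rightarrow> real" where
  "expected_ds P ds n enc dec =
     measure_pmf.expectation (replicate_pmf n P)
       (\<lambda>w. block_distortion n ds (map src_S w) (snd (snd (reconstruction enc dec w))))"

definition lim_le :: "(nat \<Rightarrow> real) \<Rightarrow> real \<Rightarrow> bool" where
  "lim_le f D \<longleftrightarrow> (\<exists>l. f \<longlonglongrightarrow> l \<and> l \<le> D)"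

definition achievable ::
  "('s \<times> 'x1 \<times> 'x2 \<times> 'y) pmf \<Rightarrow> ('x1 \<Rightarrow> 'h1 \<Rightarrow> real) \<Rightarrow> ('x2 \<Rightarrow> 'h2 \<Rightarrow> real)
    \<Rightarrow> ('s \<Rightarrow> 'hs \<Rightarrow> real) \<Rightarrow> real \<Rightarrow> real \<Rightarrow> real \<Rightarrow> real \<Rightarrow> bool" where
  "achievable P d1 d2 ds R D1 D2 Ds \<longleftrightarrow>
     0 \<le> R \<and> 0 \<le> D1 \<and> 0 \<le> D2 \<and> 0 \<le> Ds \<and>
     (\<exists>(enc :: nat \<Rightarrow> ('x1, 'x2, 'y) encoder) (dec :: nat \<Rightarrow> ('y, 'h1, 'h2, 'hs) decoder).
        (\<forall>\<^sub>F n in sequentially. is_code n R (enc n) (dec n)) \<and>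
        lim_le (\<lambda>n. expected_d1 P d1 n (enc n) (dec n)) D1 \<and>
        lim_le (\<lambda>n. expected_d2 P d2 n (enc n) (dec n)) D2 \<and>
        lim_le (\<lambda>n. expected_ds P ds n (enc n) (dec n)) Ds)"

text \<open>Extended-real valued, so that the infimum over the empty set is \<open>\<infinity>\<close>.\<close>

definition rate_distortion ::
  "('s \<times> 'x1 \<times> 'x2 \<times> 'y) pmf \<Rightarrow> ('x1 \<Rightarrow> 'h1 \<Rightarrow> real) \<Rightarrow> ('x2 \<Rightarrow> 'h2 \<Rightarrow> real)
    \<Rightarrow> ('s \<Rightarrow> 'hs \<Rightarrow> real) \<Rightarrow> real \<Rightarrow> real \<Rightarrow> real \<Rightarrow> ereal" where
  "rate_distortion P d1 d2 ds D1 D2 Ds =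
     (INF R \<in> {R. achievable P d1 d2 ds R D1 D2 Ds}. ereal R)"

text \<open>
  A conditional pmf of the reconstruction letters given \<open>(x1, x2, y)\<close> is a pmf-valued function
  \<open>q\<close>. Together with the \<open>(x1, x2, y)\<close>-marginal of the source it determines the joint pmf of
  \<open>((x1, x2, y), (xh1, xh2, sh))\<close>.
\<close>

definition joint ::
  "('s \<times> 'x1 \<times> 'x2 \<times> 'y) pmf \<Rightarrow> ('x1 \<times> 'x2 \<times> 'y \<Rightarrow> ('h1 \<times> 'h2 \<times> 'hs) pmf)
    \<Rightarrow> (('x1 \<times> 'x2 \<times> 'y) \<times> ('h1 \<times> 'h2 \<times> 'hs)) pmf" where
  "joint P q = do {a \<leftarrow> map_pmf snd P; b \<leftarrow> q a; return_pmf (a, b)}"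

definition cond_mutual_info ::
  "('s \<times> 'x1 \<times> 'x2 \<times> 'y) pmf \<Rightarrow> ('x1 \<times> 'x2 \<times> 'y \<Rightarrow> ('h1 \<times> 'h2 \<times> 'hs) pmf) \<Rightarrow> real" where
  "cond_mutual_info P q =
     prob_space.conditional_mutual_information (measure_pmf (joint P q)) 2
       (count_space UNIV) (count_space UNIV) (count_space UNIV)
       (\<lambda>((x1, x2, y), b). (x1, x2)) (\<lambda>(a, b). b) (\<lambda>((x1, x2, y), b). y)"

text \<open>
  For letters with \<open>p(x1) = 0\<close> the value is \<open>0\<close> by the convention on division; such letters do not
  contribute to any expectation.
\<close>

definition modified_ds ::
  "('s \<times> 'x1 \<times> 'x2 \<times> 'y) pmf \<Rightarrow> ('s::finite \<Rightarrow> 'hs \<Rightarrow> real) \<Rightarrow> 'x1 \<Rightarrow> 'hs \<Rightarrow> real" where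
  "modified_ds P ds x1 sh =
     1 / pmf (map_pmf src_X1 P) x1 *
       (\<Sum>s\<in>UNIV. pmf (map_pmf (\<lambda>w. (src_X1 w, src_S w)) P) (x1, s) * ds s sh)"

definition feasible ::
  "('s::finite \<times> 'x1 \<times> 'x2 \<times> 'y) pmf \<Rightarrow> ('x1 \<Rightarrow> 'h1 \<Rightarrow> real) \<Rightarrow> ('x2 \<Rightarrow> 'h2 \<Rightarrow> real)
    \<Rightarrow> ('s \<Rightarrow> 'hs \<Rightarrow> real) \<Rightarrow> real \<Rightarrow> real \<Rightarrow> real
    \<Rightarrow> ('x1 \<times> 'x2 \<times> 'y \<Rightarrow> ('h1 \<times> 'h2 \<times> 'hs) pmf) set" where
  "feasible P d1 d2 ds D1 D2 Ds =
     {q. measure_pmf.expectation (joint P q) (\<lambda>((x1, x2, y), (xh1, xh2, sh)). d1 x1 xh1) \<le> D1 \<and>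
         measure_pmf.expectation (joint P q) (\<lambda>((x1, x2, y), (xh1, xh2, sh)). d2 x2 xh2) \<le> D2 \<and>
         measure_pmf.expectation (joint P q)
           (\<lambda>((x1, x2, y), (xh1, xh2, sh)). modified_ds P ds x1 sh) \<le> Ds}"

end

(*
  The constraint on S is a constraint on X1 alone: the reconstruction is a function of (X1, X2, Y)^n,
  given which S_i has law p(s | x1_i), so E ds(S_i, Sh_i) = E ds'(X1_i, Sh_i). What remains is a
  conditional rate-distortion problem for a source letter a = (x1, x2, y), a side information
  y = g a and finitely many distortion functions of a and of the reconstruction letter b.

  Converse. For a block code F with at most 2^(nR) reconstructions per side information sequence,
  let q be the kernel whose joint law with the source is the average over i of the laws of
  (a_i, F_i(a^n)), and let rho(a, b) = q(b | a) / r(b | g a) be its information ratio. By the choice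
  of q, n I(q) = E log (prod_i rho(a_i, F_i(a^n))). By Jensen this is at most the logarithm of
  E prod_i rho(a_i, F_i(a^n)), and a union bound over the possible values of F for each y^n bounds
  the last expectation by 2^(nR). No chain rule and no convexity of I are needed, and a limit point
  of these kernels is feasible.

  Achievability. For each y^n a codebook is chosen greedily (derandomizing the product law of
  r(. | y_i)), and the encoder looks for a word jointly typical with a^n. Typicality is two-sided
  for the distortions, with a tolerance that tends to 0, so that the distortions of the codes
  converge, as the definition of achievability asks.
*)
theory Submission
  imports Defs "HOL-Real_Asymp.Real_Asymp"
begin

section \<open>Conditional mutual information as a finite sum\<close>

lemma distributed_measure_pmf:
  fixes X :: "'c \<Rightarrow> 'd"
  shows "distributed (measure_pmf J) (count_space UNIV) X (\<lambda>x. ennreal (pmf (map_pmf X J) x))"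
  by (simp add: distributed_def measure_pmf_eq_density[symmetric] map_pmf_rep_eq[symmetric])

text \<open>On finite alphabets a product of counting measures is again a counting measure and
  marginal pmfs serve as densities, so the generic density formula becomes a finite sum.
  Nonnegativity comes from the same instance; it later bounds the minimization from below and makes
  the constructed rates nonnegative.\<close>

lemma conditional_mutual_information_pmf:
  fixes J :: "'c pmf" and X :: "'c \<Rightarrow> 'x::finite" and Y :: "'c \<Rightarrow> 'y::finite"
    and Z :: "'c \<Rightarrow> 'z::finite"
  shows conditional_mutual_information_pmf_eq:
    "prob_space.conditional_mutual_information (measure_pmf J) 2
       (count_space UNIV) (count_space UNIV) (count_space UNIV) X Y Z =
     (\<Sum>(x, y, z)\<in>UNIV. pmf (map_pmf (\<lambda>w. (X w, Y w, Z w)) J) (x, y, z) *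
        log 2 (pmf (map_pmf (\<lambda>w. (X w, Y w, Z w)) J) (x, y, z) /
          (pmf (map_pmf (\<lambda>w. (X w, Z w)) J) (x, z) *
            (pmf (map_pmf (\<lambda>w. (Y w, Z w)) J) (y, z) / pmf (map_pmf Z J) z))))" (is ?eq)
    and conditional_mutual_information_pmf_nonneg:
    "0 \<le> prob_space.conditional_mutual_information (measure_pmf J) 2
       (count_space UNIV) (count_space UNIV) (count_space UNIV) X Y Z" (is ?nonneg)
proof -
  interpret information_space "measure_pmf J" 2
    by unfold_locales simp
  have pr: "count_space UNIV \<Otimes>\<^sub>M count_space UNIV = (count_space UNIV :: ('p::finite \<times> 'q::finite) measure)"
    by (simp add: pair_measure_countable)
  note sf = sigma_finite_measure_count_space_finite[OF finite[of UNIV]]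
  note thms = conditional_mutual_information_generic_eq
      conditional_mutual_information_generic_nonneg
  note inst = thms[OF sf sf sf distributed_measure_pmf _ distributed_measure_pmf,
      unfolded pr, OF _ _ distributed_measure_pmf _ distributed_measure_pmf _ distributed_measure_pmf]
  show ?eq
    by (subst inst(1)) (auto simp: integrable_count_space lebesgue_integral_count_space_finite)
  show ?nonneg
    by (rule inst(2)) (auto simp: integrable_count_space)
qed

text \<open>
  In the paper's notation: \<open>p(y)\<close>, then \<open>p(y, \<xi>)\<close> for a reconstruction letter \<open>\<xi>\<close>, and
  \<open>p(\<xi> | a) / p(\<xi> | y)\<close> at \<open>y = g a\<close>, whose value is \<open>0\<close> where \<open>p(y, \<xi>) = 0\<close>.
\<close>

definition side_mass :: "'a::finite pmf \<Rightarrow> ('a \<Rightarrow> 'y) \<Rightarrow> 'y \<Rightarrow> real" where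
  "side_mass Q g y = (\<Sum>a | g a = y. pmf Q a)"

definition side_out :: "'a::finite pmf \<Rightarrow> ('a \<Rightarrow> 'y) \<Rightarrow> ('a \<Rightarrow> 'b pmf) \<Rightarrow> 'y \<Rightarrow> 'b \<Rightarrow> real" where
  "side_out Q g q y b = (\<Sum>a | g a = y. pmf Q a * pmf (q a) b)"

definition info_ratio :: "'a::finite pmf \<Rightarrow> ('a \<Rightarrow> 'y) \<Rightarrow> ('a \<Rightarrow> 'b pmf) \<Rightarrow> 'a \<Rightarrow> 'b \<Rightarrow> real" where
  "info_ratio Q g q a b = pmf (q a) b * side_mass Q g (g a) / side_out Q g q (g a) b"

text \<open>This is I(A; B | g A) for an abstract source letter A. Terms of weight 0 vanish, so the
  value of \<open>log\<close> at 0 does not matter.\<close>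

definition cmi :: "'a::finite pmf \<Rightarrow> ('a \<Rightarrow> 'y) \<Rightarrow> ('a \<Rightarrow> 'b::finite pmf) \<Rightarrow> real" where
  "cmi Q g q = (\<Sum>a\<in>UNIV. \<Sum>b\<in>UNIV. pmf Q a * pmf (q a) b * log 2 (info_ratio Q g q a b))"

lemma pmf_map_finite: "pmf (map_pmf f (M :: 'c::finite pmf)) x = (\<Sum>c | f c = x. pmf M c)"
  by (simp add: pmf_map vimage_def measure_measure_pmf_finite)

lemma pmf_joint:
  fixes P :: "('s \<times> 'x1::finite \<times> 'x2::finite \<times> 'y::finite) pmf"
    and q :: "_ \<Rightarrow> ('h1::finite \<times> 'h2::finite \<times> 'hs::finite) pmf"
  shows "pmf (joint P q) (a, b) = pmf (map_pmf snd P) a * pmf (q a) b"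
proof -
  have "joint P q = bind_pmf (map_pmf snd P) (\<lambda>a. map_pmf (Pair a) (q a))"
    by (simp add: joint_def map_pmf_def)
  also have "pmf \<dots> (a, b) = (\<Sum>a'\<in>UNIV. pmf (map_pmf (Pair a') (q a')) (a, b) * pmf (map_pmf snd P) a')"
    unfolding pmf_bind by (rule integral_measure_pmf_real) auto
  also have "\<dots> = (\<Sum>a'\<in>UNIV. if a' = a then pmf (map_pmf snd P) a * pmf (q a) b else 0)"
    by (intro sum.cong refl) (auto simp: pmf_map_finite)
  finally show ?thesis by simp
qed

text \<open>Dividing the joint mass by p(x1, x2, y) leaves q(b | a), so the quotient inside the
  logarithm is the information ratio. A letter of mass 0 contributes 0 on both sides.\<close>

lemma cond_mutual_info_eq_cmi:
  fixes P :: "('s \<times> 'x1::finite \<times> 'x2::finite \<times> 'y::finite) pmf"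
    and q :: "_ \<Rightarrow> ('h1::finite \<times> 'h2::finite \<times> 'hs::finite) pmf"
  shows "cond_mutual_info P q = cmi (map_pmf snd P) (\<lambda>(x1, x2, y). y) q"
proof -
  define Q where "Q = map_pmf snd P"
  let ?g = "\<lambda>(x1::'x1, x2::'x2, y::'y). y"
  let ?J = "joint P q"
  have 1: "pmf (map_pmf (\<lambda>w. ((\<lambda>((x1, x2, y), b). (x1, x2)) w, snd w, (\<lambda>((x1, x2, y), b). y) w)) ?J) ((x1, x2), b, y)
      = pmf Q (x1, x2, y) * pmf (q (x1, x2, y)) b" for x1 x2 y b
  proof -
    have "pmf (map_pmf (\<lambda>w. ((\<lambda>((x1, x2, y), b). (x1, x2)) w, snd w, (\<lambda>((x1, x2, y), b). y) w)) ?J) ((x1, x2), b, y)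
      = (\<Sum>c\<in>{((x1, x2, y), b)}. pmf ?J c)"
      unfolding pmf_map_finite by (intro sum.cong) auto
    then show ?thesis by (simp add: pmf_joint Q_def)
  qed
  have 2: "pmf (map_pmf (\<lambda>w. ((\<lambda>((x1, x2, y), b). (x1, x2)) w, (\<lambda>((x1, x2, y), b). y) w)) ?J) ((x1, x2), y)
      = pmf Q (x1, x2, y)" for x1 x2 y
  proof -
    have "pmf (map_pmf (\<lambda>w. ((\<lambda>((x1, x2, y), b). (x1, x2)) w, (\<lambda>((x1, x2, y), b). y) w)) ?J) ((x1, x2), y)
      = (\<Sum>c\<in>Pair (x1, x2, y) ` UNIV. pmf ?J c)"
      unfolding pmf_map_finite by (intro sum.cong) auto
    also have "\<dots> = (\<Sum>b\<in>UNIV. pmf ?J ((x1, x2, y), b))"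
      by (subst sum.reindex) (auto simp: inj_on_def)
    finally show ?thesis by (simp add: pmf_joint Q_def sum_pmf_eq_1 flip: sum_distrib_left)
  qed
  have 3: "pmf (map_pmf (\<lambda>w. (snd w, (\<lambda>((x1, x2, y), b). y) w)) ?J) (b, y) = side_out Q ?g q y b" for b y
  proof -
    have "pmf (map_pmf (\<lambda>w. (snd w, (\<lambda>((x1, x2, y), b). y) w)) ?J) (b, y)
      = (\<Sum>c\<in>(\<lambda>a. (a, b)) ` {a. ?g a = y}. pmf ?J c)"
      unfolding pmf_map_finite by (intro sum.cong) auto
    also have "\<dots> = (\<Sum>a | ?g a = y. pmf ?J (a, b))"
      by (subst sum.reindex) (auto simp: inj_on_def)
    finally show ?thesis by (simp add: pmf_joint Q_def side_out_def)
  qed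
  have 4: "pmf (map_pmf (\<lambda>((x1, x2, y), b). y) ?J) y = side_mass Q ?g y" for y
  proof -
    have "pmf (map_pmf (\<lambda>((x1, x2, y), b). y) ?J) y
      = (\<Sum>c\<in>{a. ?g a = y} \<times> UNIV. pmf ?J c)"
      unfolding pmf_map_finite by (intro sum.cong) auto
    also have "\<dots> = (\<Sum>a | ?g a = y. \<Sum>b\<in>UNIV. pmf ?J (a, b))"
      by (simp add: sum.cartesian_product)
    finally show ?thesis
      by (simp add: pmf_joint Q_def side_mass_def sum_pmf_eq_1 flip: sum_distrib_left)
  qed
  have "cond_mutual_info P q = (\<Sum>((x1, x2), b, y)\<in>UNIV. pmf Q (x1, x2, y) * pmf (q (x1, x2, y)) b *
      log 2 (pmf Q (x1, x2, y) * pmf (q (x1, x2, y)) b / (pmf Q (x1, x2, y) * (side_out Q ?g q y b / side_mass Q ?g y))))"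
    unfolding cond_mutual_info_def
    apply (subst conditional_mutual_information_pmf_eq)
    apply (rule sum.cong[OF refl])
    subgoal for t
      apply (cases t)
      using 1[of "fst (fst t)" "snd (fst t)" "fst (snd t)" "snd (snd t)"]
        2[of "fst (fst t)" "snd (fst t)" "snd (snd t)"] 3[of "fst (snd t)" "snd (snd t)"] 4[of "snd (snd t)"]
      by (auto simp: snd_def[abs_def])
    done
  also have "\<dots> = (\<Sum>(a, b)\<in>UNIV. pmf Q a * pmf (q a) b * log 2 (info_ratio Q ?g q a b))"
    by (rule sum.reindex_bij_witness[where j = "\<lambda>((x1, x2), b, y). ((x1, x2, y), b)"
          and i = "\<lambda>((x1, x2, y), b). ((x1, x2), b, y)"])
       (auto simp: info_ratio_def)
  also have "\<dots> = cmi Q ?g q"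
    unfolding cmi_def by (simp add: sum.cartesian_product)
  finally show ?thesis unfolding Q_def .
qed

lemma cond_mutual_info_nonneg:
  fixes P :: "('s \<times> 'x1::finite \<times> 'x2::finite \<times> 'y::finite) pmf"
    and q :: "_ \<Rightarrow> ('h1::finite \<times> 'h2::finite \<times> 'hs::finite) pmf"
  shows "0 \<le> cond_mutual_info P q"
  unfolding cond_mutual_info_def by (rule conditional_mutual_information_pmf_nonneg)

section \<open>Sums over sequences, covering and concentration\<close>

lemma finite_seqs [simp, intro]: "finite (seqs n :: 'a::finite list set)"
  using finite_lists_length_eq[OF finite[of UNIV], of n] by (simp add: seqs_def)

lemma seqs_0 [simp]: "seqs 0 = {[]}"
  by (auto simp: seqs_def)

lemma sum_seqs_Suc:
  "(\<Sum>xs\<in>seqs (Suc n). f xs) = (\<Sum>x\<in>UNIV. \<Sum>xs\<in>seqs n. f (x # xs :: 'a::finite list))"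
  unfolding sum.cartesian_product
  by (rule sum.reindex_bij_witness[where i = "\<lambda>(x, xs). x # xs" and j = "\<lambda>xs. (hd xs, tl xs)"])
     (auto simp: seqs_def length_Suc_conv)

lemma sum_seqs_prod:
  fixes h :: "nat \<Rightarrow> 'a::finite \<Rightarrow> real"
  shows "(\<Sum>xs\<in>seqs n. \<Prod>i<n. h i (xs ! i)) = (\<Prod>i<n. \<Sum>x\<in>UNIV. h i x)"
proof (induction n arbitrary: h)
  case (Suc n)
  show ?case
    unfolding sum_seqs_Suc prod.lessThan_Suc_shift
    by (simp add: Suc.IH[of "\<lambda>i. h (Suc i)"] flip: sum_distrib_left sum_distrib_right)
qed simp

text \<open>The constraint \<open>map g v = ys\<close> acts on each coordinate separately, so it can
  be absorbed into the factors as indicators before the product and the sum are exchanged. This is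
  how sums over the blocks with a given side information sequence factor.\<close>

lemma sum_seqs_map_prod:
  fixes h :: "nat \<Rightarrow> 'a::finite \<Rightarrow> real"
  assumes ys: "ys \<in> seqs n"
  shows "(\<Sum>v | v \<in> seqs n \<and> map g v = ys. \<Prod>i<n. h i (v ! i)) = (\<Prod>i<n. \<Sum>x | g x = ys ! i. h i x)"
proof -
  have "(\<Prod>i<n. \<Sum>x | g x = ys ! i. h i x) = (\<Prod>i<n. \<Sum>x\<in>UNIV. if g x = ys ! i then h i x else 0)"
    by (intro prod.cong refl) (simp add: sum.If_cases)
  also have "\<dots> = (\<Sum>v\<in>seqs n. \<Prod>i<n. if g (v ! i) = ys ! i then h i (v ! i) else 0)"
    by (subst sum_seqs_prod) simp
  also have "\<dots> = (\<Sum>v\<in>seqs n. if map g v = ys then \<Prod>i<n. h i (v ! i) else 0)"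
  proof (intro sum.cong refl)
    fix v :: "'a list" assume v: "v \<in> seqs n"
    have eq: "map g v = ys \<longleftrightarrow> (\<forall>i<n. g (v ! i) = ys ! i)"
      using v ys by (auto simp: seqs_def list_eq_iff_nth_eq)
    show "(\<Prod>i<n. if g (v ! i) = ys ! i then h i (v ! i) else 0) =
        (if map g v = ys then \<Prod>i<n. h i (v ! i) else 0)"
    proof (cases "map g v = ys")
      case True
      then show ?thesis using eq by (auto intro!: prod.cong)
    next
      case False
      then obtain i where "i < n" "g (v ! i) \<noteq> ys ! i" using eq by blast
      then have "(\<Prod>i<n. if g (v ! i) = ys ! i then h i (v ! i) else 0) = 0"
        by (intro prod_zero) auto
      then show ?thesis using False by simp
    qed
  qed
  also have "\<dots> = (\<Sum>v | v \<in> seqs n \<and> map g v = ys. \<Prod>i<n. h i (v ! i))"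
    by (subst sum.inter_filter) auto
  finally show ?thesis by simp
qed

section \<open>Block laws of memoryless sources\<close>

lemma pmf_replicate_pmf:
  assumes "xs \<in> seqs n"
  shows "pmf (replicate_pmf n p) xs = (\<Prod>i<n. pmf p (xs ! i :: 'a::finite))"
  using assms
proof (induction n arbitrary: xs)
  case (Suc n)
  then obtain y ys where xs: "xs = y # ys" "ys \<in> seqs n"
    by (auto simp: seqs_def length_Suc_conv)
  have "replicate_pmf (Suc n) p = map_pmf (\<lambda>(x, xs). x # xs) (pair_pmf p (replicate_pmf n p))"
    by (simp add: map_pmf_def pair_pmf_def bind_assoc_pmf bind_return_pmf)
  moreover have "pmf (map_pmf (\<lambda>(x, xs). x # xs) (pair_pmf p (replicate_pmf n p))) ((\<lambda>(x, xs). x # xs) (y, ys))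
      = pmf (pair_pmf p (replicate_pmf n p)) (y, ys)"
    by (rule pmf_map_inj') (auto simp: inj_def)
  ultimately show ?case
    using xs by (simp add: pmf_pair Suc.IH prod.lessThan_Suc_shift del: replicate_pmf.simps prod.lessThan_Suc)
qed simp

lemma expectation_replicate_pmf:
  fixes f :: "'a::finite list \<Rightarrow> real"
  shows "measure_pmf.expectation (replicate_pmf n p) f =
    (\<Sum>v\<in>seqs n. (\<Prod>i<n. pmf p (v ! i)) * f v)"
proof -
  have "measure_pmf.expectation (replicate_pmf n p) f = (\<Sum>v\<in>seqs n. f v * pmf (replicate_pmf n p) v)"
    by (rule integral_measure_pmf_real) (simp, auto simp: set_replicate_pmf seqs_def)
  then show ?thesis by (simp add: pmf_replicate_pmf mult.commute)
qed

section \<open>Codebook selection and the covering inequality\<close>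

text \<open>
  Method of conditional expectations: the bound is the expected uncovered weight for \<open>M\<close>
  independent codewords drawn from \<open>r\<close>.
\<close>

lemma greedy_codebook:
  fixes w :: "'a \<Rightarrow> real" and r :: "'b \<Rightarrow> real"
  assumes A: "finite A" and B: "finite B"
    and r: "\<And>b. b \<in> B \<Longrightarrow> 0 \<le> r b" "sum r B = 1"
  shows "\<exists>c :: nat \<Rightarrow> 'b. (\<forall>m. c m \<in> B) \<and>
    (\<Sum>a | a \<in> A \<and> (\<forall>m<M. c m \<notin> G a). w a) \<le> (\<Sum>a\<in>A. w a * (1 - sum r (B \<inter> G a)) ^ M)"
proof (induction M arbitrary: w)
  case 0
  have "B \<noteq> {}" using r(2) by auto
  then obtain b where "b \<in> B" by blast
  then show ?case by (intro exI[of _ "\<lambda>_. b"]) simp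
next
  case (Suc M)
  let ?t = "\<lambda>a. 1 - sum r (B \<inter> G a)"
  let ?f = "\<lambda>b. \<Sum>a | a \<in> A \<and> b \<notin> G a. w a * ?t a ^ M"
  have t: "(\<Sum>b\<in>B. r b * (if b \<notin> G a then 1 else 0)) = ?t a" for a
  proof -
    have "?t a = sum r B - sum r (B \<inter> G a)" using r by simp
    also have "\<dots> = sum r (B - G a)"
      using sum.Int_Diff[OF B, of r "G a"] by simp
    also have "\<dots> = (\<Sum>b\<in>B. if b \<notin> G a then r b else 0)"
      by (subst sum.inter_filter[symmetric]) (auto simp: B set_diff_eq)
    finally show ?thesis by (auto intro!: sum.cong)
  qed
  have f: "?f b = (\<Sum>a\<in>A. w a * ?t a ^ M * (if b \<notin> G a then 1 else 0))" for b
    by (subst sum.inter_filter) (auto simp: A intro!: sum.cong)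
  \<comment> \<open>Averaging over the first codeword supplies exactly the missing factor of the
    power.\<close>
  have avg: "(\<Sum>b\<in>B. r b * ?f b) = (\<Sum>a\<in>A. w a * ?t a ^ Suc M)"
  proof -
    have "(\<Sum>b\<in>B. r b * ?f b) = (\<Sum>a\<in>A. \<Sum>b\<in>B. r b * (w a * ?t a ^ M * (if b \<notin> G a then 1 else 0)))"
      unfolding f sum_distrib_left by (rule sum.swap)
    also have "\<dots> = (\<Sum>a\<in>A. w a * ?t a ^ M * (\<Sum>b\<in>B. r b * (if b \<notin> G a then 1 else 0)))"
      unfolding sum_distrib_left by (simp add: mult_ac)
    finally show ?thesis unfolding t by (simp add: mult_ac)
  qed
  \<comment> \<open>Some codeword does no worse than the average.\<close>
  obtain b where b: "b \<in> B" "?f b \<le> (\<Sum>a\<in>A. w a * ?t a ^ Suc M)"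
  proof (rule ccontr)
    assume neg: "\<not> thesis"
    let ?L = "\<Sum>a\<in>A. w a * ?t a ^ Suc M"
    have lt: "?L < ?f b" if "b \<in> B" for b using that neg \<open>\<And>b. b \<in> B \<Longrightarrow> ?f b \<le> ?L \<Longrightarrow> thesis\<close> by force
    obtain b0 where b0: "b0 \<in> B" "r b0 > 0"
      using r by (metis less_eq_real_def sum.neutral zero_neq_one)
    have "(\<Sum>b\<in>B. r b * ?L) < (\<Sum>b\<in>B. r b * ?f b)"
      using B b0 lt r(1) by (intro sum_strict_mono_ex1 ballI mult_left_mono bexI[of _ b0]) (auto intro: less_imp_le)
    then show False unfolding avg by (simp add: r(2) flip: sum_distrib_right)
  qed
  \<comment> \<open>What \<open>b\<close> covers gets weight 0; the induction hypothesis, stated for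
    every weight, then chooses the other \<open>M\<close> codewords.\<close>
  let ?w' = "\<lambda>a. if b \<notin> G a then w a else 0"
  obtain c where c: "\<forall>m. c m \<in> B"
    "(\<Sum>a | a \<in> A \<and> (\<forall>m<M. c m \<notin> G a). ?w' a) \<le> (\<Sum>a\<in>A. ?w' a * ?t a ^ M)"
    using Suc.IH[of ?w'] by blast
  let ?c = "case_nat b c"
  have "(\<Sum>a | a \<in> A \<and> (\<forall>m<Suc M. ?c m \<notin> G a). w a) = (\<Sum>a | a \<in> A \<and> (\<forall>m<M. c m \<notin> G a). ?w' a)"
  proof -
    have *: "(\<forall>m<Suc M. ?c m \<notin> G a) \<longleftrightarrow> b \<notin> G a \<and> (\<forall>m<M. c m \<notin> G a)" for a
      by (auto simp: less_Suc_eq_0_disj)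
    show ?thesis unfolding *
      by (rule sum.mono_neutral_cong_left) (auto simp: A)
  qed
  also have "\<dots> \<le> (\<Sum>a\<in>A. ?w' a * ?t a ^ M)" by (rule c(2))
  also have "\<dots> = ?f b" unfolding f by (intro sum.cong) auto
  also have "\<dots> \<le> (\<Sum>a\<in>A. w a * ?t a ^ Suc M)" by (rule b(2))
  finally show ?case
    using b c by (intro exI[of _ ?c]) (auto split: nat.split)
qed

text \<open>First 1 - r is at most exp (-r) and r is at least y x; then convexity of exp on the
  segment from 0 to -M y separates x from M. In use, r is the probability that a random codeword
  covers a source block, x the conditional probability of its typical words, and y the cost of the
  change of measure.\<close>

lemma exp_covering_bound:
  fixes r x y :: real
  assumes "0 \<le> r" "r \<le> 1" "0 \<le> x" "x \<le> 1" "y * x \<le> r"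
  shows "(1 - r) ^ M \<le> 1 - x + exp (- (real M * y))"
proof -
  have "(1 - r) ^ M \<le> exp (- r) ^ M"
    using assms exp_ge_add_one_self[of "- r"] by (intro power_mono) auto
  also have "\<dots> = exp (- (real M * r))" by (simp flip: exp_of_nat_mult)
  also have "\<dots> \<le> exp (- (real M * (y * x)))" using assms(5) by (simp add: mult_left_mono)
  also have "\<dots> = exp ((1 - x) *\<^sub>R 0 + x *\<^sub>R (- (real M * y)))" by (simp add: mult_ac)
  also have "\<dots> \<le> (1 - x) * exp 0 + x * exp (- (real M * y))"
    using assms by (intro convex_onD[OF exp_convex]) auto
  also have "\<dots> \<le> (1 - x) + 1 * exp (- (real M * y))" using assms by (intro add_mono mult_right_mono) auto
  finally show ?thesis by simp
qed

text \<open>The offset \<open>t\<close> carries the terms of the coordinates already split off,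
  which makes the induction go through; the cross term vanishes because \<open>f\<close> has mean
  0.\<close>

lemma second_moment_seqs:
  fixes J :: "'a::finite \<Rightarrow> 'b::finite \<Rightarrow> real"
  assumes J1: "(\<Sum>a\<in>UNIV. \<Sum>b\<in>UNIV. J a b) = 1"
    and f0: "(\<Sum>a\<in>UNIV. \<Sum>b\<in>UNIV. J a b * f a b) = 0"
  shows "(\<Sum>v\<in>seqs n. \<Sum>u\<in>seqs n. (\<Prod>i<n. J (v ! i) (u ! i)) * (t + (\<Sum>i<n. f (v ! i) (u ! i)))\<^sup>2) =
    t\<^sup>2 + n * (\<Sum>a\<in>UNIV. \<Sum>b\<in>UNIV. J a b * (f a b)\<^sup>2)"
proof (induction n arbitrary: t)
  case (Suc n)
  let ?s = "\<Sum>a\<in>UNIV. \<Sum>b\<in>UNIV. J a b * (f a b)\<^sup>2"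
  have "(\<Sum>v\<in>seqs (Suc n). \<Sum>u\<in>seqs (Suc n). (\<Prod>i<Suc n. J (v ! i) (u ! i)) * (t + (\<Sum>i<Suc n. f (v ! i) (u ! i)))\<^sup>2)
    = (\<Sum>a\<in>UNIV. \<Sum>v\<in>seqs n. \<Sum>b\<in>UNIV. \<Sum>u\<in>seqs n. J a b * ((\<Prod>i<n. J (v ! i) (u ! i)) * ((t + f a b) + (\<Sum>i<n. f (v ! i) (u ! i)))\<^sup>2))"
    unfolding sum_seqs_Suc prod.lessThan_Suc_shift sum.lessThan_Suc_shift by (simp add: mult_ac add_ac)
  also have "\<dots> = (\<Sum>a\<in>UNIV. \<Sum>b\<in>UNIV. J a b * (\<Sum>v\<in>seqs n. \<Sum>u\<in>seqs n. (\<Prod>i<n. J (v ! i) (u ! i)) * ((t + f a b) + (\<Sum>i<n. f (v ! i) (u ! i)))\<^sup>2))"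
    unfolding sum_distrib_left by (intro sum.cong[OF refl] sum.swap)
  also have "\<dots> = (\<Sum>a\<in>UNIV. \<Sum>b\<in>UNIV. J a b * ((t + f a b)\<^sup>2 + n * ?s))"
    unfolding Suc.IH ..
  also have "\<dots> = (\<Sum>a\<in>UNIV. \<Sum>b\<in>UNIV. J a b * (t\<^sup>2 + n * ?s) + 2 * t * (J a b * f a b) + J a b * (f a b)\<^sup>2)"
    by (intro sum.cong refl) (simp add: power2_eq_square algebra_simps)
  also have "\<dots> = (\<Sum>a\<in>UNIV. \<Sum>b\<in>UNIV. J a b) * (t\<^sup>2 + n * ?s) + 2 * t * (\<Sum>a\<in>UNIV. \<Sum>b\<in>UNIV. J a b * f a b) + ?s"
    by (simp only: sum.distrib sum_distrib_left[symmetric] sum_distrib_right[symmetric])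
  also have "\<dots> = t\<^sup>2 + Suc n * ?s" unfolding J1 f0 by (simp add: algebra_simps)
  finally show ?case .
qed simp

lemma chebyshev_seqs:
  fixes J :: "'a::finite \<Rightarrow> 'b::finite \<Rightarrow> real"
  assumes J0: "\<And>a b. 0 \<le> J a b" and J1: "(\<Sum>a\<in>UNIV. \<Sum>b\<in>UNIV. J a b) = 1"
    and \<mu>: "\<mu> = (\<Sum>a\<in>UNIV. \<Sum>b\<in>UNIV. J a b * f a b)"
    and \<delta>: "0 < \<delta>" and n: "0 < n"
  shows "(\<Sum>v\<in>seqs n. \<Sum>u\<in>seqs n. (\<Prod>i<n. J (v ! i) (u ! i)) *
      of_bool (real n * \<delta> < \<bar>(\<Sum>i<n. f (v ! i) (u ! i)) - n * \<mu>\<bar>)) \<le>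
    (\<Sum>a\<in>UNIV. \<Sum>b\<in>UNIV. J a b * (f a b - \<mu>)\<^sup>2) / (n * \<delta>\<^sup>2)" (is "?L \<le> ?R")
proof -
  \<comment> \<open>Markov's inequality for the squared deviation. The summand \<open>0 +\<close> is
    the offset t = 0 of the second moment formula.\<close>
  have "?L \<le> (\<Sum>v\<in>seqs n. \<Sum>u\<in>seqs n. (\<Prod>i<n. J (v ! i) (u ! i)) *
      ((0 + (\<Sum>i<n. f (v ! i) (u ! i) - \<mu>))\<^sup>2 / (real n * \<delta>)\<^sup>2))"
  proof (intro sum_mono mult_left_mono)
    fix v :: "'a list" and u :: "'b list"
    let ?x = "(\<Sum>i<n. f (v ! i) (u ! i)) - n * \<mu>"
    have e: "0 + (\<Sum>i<n. f (v ! i) (u ! i) - \<mu>) = ?x" by (simp add: sum_subtractf)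
    show "of_bool (real n * \<delta> < \<bar>?x\<bar>) \<le> (0 + (\<Sum>i<n. f (v ! i) (u ! i) - \<mu>))\<^sup>2 / (real n * \<delta>)\<^sup>2"
      unfolding e
    proof (cases "real n * \<delta> < \<bar>?x\<bar>")
      case True
      then have "(real n * \<delta>)\<^sup>2 \<le> \<bar>?x\<bar>\<^sup>2" using \<delta> by (intro power_mono) auto
      then show "of_bool (real n * \<delta> < \<bar>?x\<bar>) \<le> ?x\<^sup>2 / (real n * \<delta>)\<^sup>2"
        using \<delta> n True by (simp add: le_divide_eq)
    qed auto
  qed (auto intro: prod_nonneg J0)
  also have "\<dots> = (\<Sum>v\<in>seqs n. \<Sum>u\<in>seqs n. (\<Prod>i<n. J (v ! i) (u ! i)) *
      (0 + (\<Sum>i<n. f (v ! i) (u ! i) - \<mu>))\<^sup>2) / (real n * \<delta>)\<^sup>2"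
    by (simp add: sum_divide_distrib)
  also have "\<dots> = (0\<^sup>2 + n * (\<Sum>a\<in>UNIV. \<Sum>b\<in>UNIV. J a b * (f a b - \<mu>)\<^sup>2)) / (real n * \<delta>)\<^sup>2"
    by (subst second_moment_seqs[where f = "\<lambda>a b. f a b - \<mu>"])
       (simp_all add: J1 \<mu> right_diff_distrib sum_subtractf flip: sum_distrib_right)
  also have "\<dots> = ?R" using n by (simp add: power2_eq_square)
  finally show ?thesis .
qed

section \<open>Converse\<close>

lemma side_mass_nonneg: "0 \<le> side_mass Q g y"
  by (simp add: side_mass_def sum_nonneg)

lemma side_out_nonneg: "0 \<le> side_out Q g q y b"
  by (simp add: side_out_def sum_nonneg)

lemma sum_side_mass: "(\<Sum>y\<in>UNIV. side_mass Q g (y :: 'y::finite)) = 1"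
  unfolding side_mass_def using sum.group[of UNIV UNIV g "pmf Q"] by (simp add: sum_pmf_eq_1)

lemma info_ratio_nonneg: "0 \<le> info_ratio Q g q a b"
  by (simp add: info_ratio_def side_mass_nonneg side_out_nonneg)

lemma side_mass_ge: "pmf Q a \<le> side_mass Q g (g a)"
  unfolding side_mass_def by (intro member_le_sum) auto

lemma side_out_ge: "pmf Q a * pmf (q a) b \<le> side_out Q g q (g a) b"
  unfolding side_out_def by (intro member_le_sum) auto

lemma info_ratio_pos:
  assumes "0 < pmf Q a" "0 < pmf (q a) b"
  shows "0 < info_ratio Q g q a b"
proof -
  have "0 < side_mass Q g (g a)" "0 < side_out Q g q (g a) b"
    using assms side_mass_ge[of Q a g] side_out_ge[of Q a q b g] mult_pos_pos[OF assms] by linarith+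
  then show ?thesis using assms by (simp add: info_ratio_def)
qed

section \<open>Kernels from joint masses\<close>

lemma ex_pmf_finite:
  fixes p :: "'b::finite \<Rightarrow> real"
  assumes "\<And>b. 0 \<le> p b" "sum p UNIV = 1"
  shows "\<exists>m. \<forall>b. pmf m b = p b"
proof -
  have "(\<integral>\<^sup>+ b. ennreal (p b) \<partial>count_space UNIV) = 1"
    using assms by (simp add: nn_integral_count_space_finite sum_ennreal)
  then show ?thesis using pmf_embed_pmf[of p] assms by metis
qed

text \<open>Disintegration by division. Where \<open>Q\<close> has mass 0 the whole row of
  \<open>J\<close> vanishes, and any pmf serves as the conditional law.\<close>

lemma ex_kernel:
  fixes Q :: "'a::finite pmf" and J :: "'a \<Rightarrow> 'b::finite \<Rightarrow> real"
  assumes J0: "\<And>a b. 0 \<le> J a b" and J1: "\<And>a. (\<Sum>b\<in>UNIV. J a b) = pmf Q a"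
  shows "\<exists>q. \<forall>a b. pmf Q a * pmf (q a) b = J a b"
proof -
  have "\<exists>m. \<forall>b. pmf Q a * pmf m b = J a b" for a
  proof (cases "pmf Q a = 0")
    case True
    then have "J a b = 0" for b using J1[of a] J0[of a] by (simp add: sum_nonneg_eq_0_iff)
    then show ?thesis using True by simp
  next
    case False
    then have "\<exists>m. \<forall>b. pmf m b = J a b / pmf Q a"
      by (intro ex_pmf_finite) (auto simp: J0 J1 simp flip: sum_divide_distrib)
    then show ?thesis using False by (metis nonzero_mult_div_cancel_left times_divide_eq_right)
  qed
  then show ?thesis by metis
qed

lemma sum_seqs_coordinate:
  fixes Q :: "'a::finite pmf"
  assumes "i < n"
  shows "(\<Sum>v\<in>seqs n. (\<Prod>j<n. pmf Q (v ! j)) * f (v ! i)) = (\<Sum>a\<in>UNIV. pmf Q a * f a)"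
proof -
  let ?h = "\<lambda>j x. pmf Q x * (if j = i then f x else 1)"
  have "(\<Sum>v\<in>seqs n. (\<Prod>j<n. pmf Q (v ! j)) * f (v ! i)) = (\<Sum>v\<in>seqs n. \<Prod>j<n. ?h j (v ! j))"
    using assms by (simp add: prod.distrib prod.delta)
  also have "\<dots> = (\<Prod>j<n. \<Sum>a\<in>UNIV. ?h j a)" by (rule sum_seqs_prod)
  also have "\<dots> = (\<Prod>j<n. if j = i then \<Sum>a\<in>UNIV. pmf Q a * f a else 1)"
    by (intro prod.cong) (auto simp: sum_pmf_eq_1)
  finally show ?thesis using assms by (simp add: prod.delta)
qed

text \<open>The kernel is the conditional law of the output letter given the source letter at a
  uniformly random position of the block. Each position has law \<open>Q\<close>, whatever
  \<open>F\<close> does, so the first marginal of \<open>J\<close> is \<open>Q\<close>.\<close>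

lemma ex_average_kernel:
  fixes Q :: "'a::finite pmf" and F :: "'a list \<Rightarrow> 'b::finite list"
  assumes n: "0 < n"
  shows "\<exists>q. \<forall>f :: 'a \<Rightarrow> 'b \<Rightarrow> real. (\<Sum>a\<in>UNIV. \<Sum>b\<in>UNIV. pmf Q a * pmf (q a) b * f a b) =
    (\<Sum>v\<in>seqs n. (\<Prod>i<n. pmf Q (v ! i)) * (1 / n * (\<Sum>i<n. f (v ! i) (F v ! i))))"
proof -
  let ?W = "\<lambda>v. \<Prod>i<n. pmf Q (v ! i)"
  define J where "J a b = (\<Sum>v\<in>seqs n. ?W v * (1 / n * (\<Sum>i<n. of_bool (v ! i = a \<and> F v ! i = b))))" for a b
  have avg: "(\<Sum>a\<in>UNIV. \<Sum>b\<in>UNIV. J a b * f a b) =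
      (\<Sum>v\<in>seqs n. ?W v * (1 / n * (\<Sum>i<n. f (v ! i) (F v ! i))))" for f
  proof -
    have "(\<Sum>a\<in>UNIV. \<Sum>b\<in>UNIV. J a b * f a b) = (\<Sum>(a, b)\<in>UNIV. J a b * f a b)"
      by (simp add: sum.cartesian_product)
    also have "\<dots> = (\<Sum>x\<in>UNIV. \<Sum>v\<in>seqs n. \<Sum>i<n. ?W v * (1 / n) * (of_bool (v ! i = fst x \<and> F v ! i = snd x) * f (fst x) (snd x)))"
      unfolding J_def by (intro sum.cong refl) (simp add: split_beta sum_distrib_left sum_distrib_right mult_ac del: sum_of_bool_eq)
    also have "\<dots> = (\<Sum>v\<in>seqs n. \<Sum>x\<in>UNIV. \<Sum>i<n. ?W v * (1 / n) * (of_bool (v ! i = fst x \<and> F v ! i = snd x) * f (fst x) (snd x)))"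
      by (rule sum.swap)
    also have "\<dots> = (\<Sum>v\<in>seqs n. \<Sum>i<n. \<Sum>x\<in>UNIV. ?W v * (1 / n) * (of_bool (v ! i = fst x \<and> F v ! i = snd x) * f (fst x) (snd x)))"
      by (intro sum.cong refl sum.swap)
    also have "\<dots> = (\<Sum>v\<in>seqs n. \<Sum>i<n. \<Sum>x\<in>UNIV. if x = (v ! i, F v ! i) then ?W v * (1 / n) * f (v ! i) (F v ! i) else 0)"
      by (intro sum.cong refl) auto
    also have "\<dots> = (\<Sum>v\<in>seqs n. ?W v * (1 / n * (\<Sum>i<n. f (v ! i) (F v ! i))))"
      by (simp add: sum_distrib_left mult_ac)
    finally show ?thesis .
  qed
  have "\<exists>q. \<forall>a b. pmf Q a * pmf (q a) b = J a b"
  proof (rule ex_kernel)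
    show "0 \<le> J a b" for a b unfolding J_def by (intro sum_nonneg mult_nonneg_nonneg prod_nonneg) auto
    fix a
    \<comment> \<open>The marginal is an average of the kind computed in \<open>avg\<close>, for the
      indicator of the letter \<open>a\<close>.\<close>
    have "(\<Sum>b\<in>UNIV. J a b) = (\<Sum>a'\<in>UNIV. \<Sum>b\<in>UNIV. J a' b * of_bool (a' = a))"
      by (subst sum.swap) simp
    also have "\<dots> = (\<Sum>v\<in>seqs n. \<Sum>i<n. 1 / n * (?W v * of_bool (v ! i = a)))"
      unfolding avg by (intro sum.cong refl) (simp add: sum_distrib_left mult_ac del: sum_of_bool_eq)
    also have "\<dots> = (\<Sum>i<n. 1 / n * (\<Sum>v\<in>seqs n. ?W v * of_bool (v ! i = a)))"
      unfolding sum_distrib_left by (rule sum.swap)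
    also have "\<dots> = (\<Sum>i<n. 1 / n * (\<Sum>x\<in>UNIV. pmf Q x * of_bool (x = a)))"
      by (intro sum.cong refl arg_cong2[where f = "(*)"] sum_seqs_coordinate) auto
    also have "\<dots> = pmf Q a" using n by simp
    finally show "(\<Sum>b\<in>UNIV. J a b) = pmf Q a" .
  qed
  then obtain q where q: "pmf Q a * pmf (q a) b = J a b" for a b by blast
  show ?thesis by (intro exI[of _ q] allI) (simp only: q avg)
qed

text \<open>For a fixed output word the sum over the blocks with side information \<open>ys\<close>
  factors, and each factor is at most p(y_i). Summing over the at most \<open>M\<close> words that
  \<open>F\<close> can produce for \<open>ys\<close>, and then over \<open>ys\<close>, leaves
  \<open>M\<close>.\<close>

lemma sum_info_ratio_le:
  fixes Q :: "'a::finite pmf" and g :: "'a \<Rightarrow> 'y::finite" and F :: "'a list \<Rightarrow> 'b::finite list"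
  assumes F: "\<And>v. v \<in> seqs n \<Longrightarrow> F v \<in> seqs n"
    and card: "\<And>ys. ys \<in> seqs n \<Longrightarrow> real (card (F ` {v \<in> seqs n. map g v = ys})) \<le> M"
  shows "(\<Sum>v\<in>seqs n. \<Prod>i<n. pmf Q (v ! i) * info_ratio Q g q (v ! i) (F v ! i)) \<le> M"
proof -
  let ?h = "\<lambda>a b. pmf Q a * info_ratio Q g q a b"
  have h0: "0 \<le> ?h a b" for a b by (simp add: info_ratio_nonneg)
  \<comment> \<open>The sum of p(a) q(b | a) over the fibre is p(y, b), which cancels the
    denominator. If p(y, b) = 0, the convention for division makes the sum 0.\<close>
  have hs: "(\<Sum>a | g a = y. ?h a b) \<le> side_mass Q g y" for y b
  proof -
    have "(\<Sum>a | g a = y. ?h a b) = side_out Q g q y b * (side_mass Q g y / side_out Q g q y b)"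
      unfolding side_out_def[of Q g q y b] sum_distrib_right
      by (intro sum.cong refl) (auto simp: info_ratio_def side_out_def)
    then show ?thesis by (cases "side_out Q g q y b = 0") (auto simp: side_mass_nonneg)
  qed
  let ?V = "\<lambda>ys. {v. v \<in> seqs n \<and> map g v = ys}"
  have fV: "finite (?V ys)" for ys by simp
  have "(\<Sum>v\<in>seqs n. \<Prod>i<n. ?h (v ! i) (F v ! i)) = (\<Sum>ys\<in>seqs n. \<Sum>v\<in>?V ys. \<Prod>i<n. ?h (v ! i) (F v ! i))"
    by (rule sum.group[symmetric]) (simp, simp, auto simp: seqs_def)
  also have "\<dots> \<le> (\<Sum>ys\<in>seqs n. M * (\<Prod>i<n. side_mass Q g (ys ! i)))"
  proof (intro sum_mono)
    fix ys :: "'y list" assume ys: "ys \<in> seqs n"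
    have "(\<Sum>v\<in>?V ys. \<Prod>i<n. ?h (v ! i) (F v ! i)) = (\<Sum>u\<in>F ` ?V ys. \<Sum>v | v \<in> ?V ys \<and> F v = u. \<Prod>i<n. ?h (v ! i) (F v ! i))"
      using fV by (intro sum.group[symmetric]) auto
    \<comment> \<open>Union bound: for each possible word \<open>u\<close> the condition F v = u is
      dropped, which decouples the coordinates.\<close>
    also have "\<dots> \<le> (\<Sum>u\<in>F ` ?V ys. \<Sum>v\<in>?V ys. \<Prod>i<n. ?h (v ! i) (u ! i))"
    proof (intro sum_mono)
      fix u
      have "(\<Sum>v | v \<in> ?V ys \<and> F v = u. \<Prod>i<n. ?h (v ! i) (F v ! i)) = (\<Sum>v | v \<in> ?V ys \<and> F v = u. \<Prod>i<n. ?h (v ! i) (u ! i))"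
        by (intro sum.cong) auto
      also have "\<dots> \<le> (\<Sum>v\<in>?V ys. \<Prod>i<n. ?h (v ! i) (u ! i))"
        by (intro sum_mono2 fV) (auto intro!: prod_nonneg h0)
      finally show "(\<Sum>v | v \<in> ?V ys \<and> F v = u. \<Prod>i<n. ?h (v ! i) (F v ! i)) \<le> (\<Sum>v\<in>?V ys. \<Prod>i<n. ?h (v ! i) (u ! i))" .
    qed
    also have "\<dots> = (\<Sum>u\<in>F ` ?V ys. \<Prod>i<n. \<Sum>a | g a = ys ! i. ?h a (u ! i))"
      by (intro sum.cong refl sum_seqs_map_prod ys)
    also have "\<dots> \<le> (\<Sum>u\<in>F ` ?V ys. \<Prod>i<n. side_mass Q g (ys ! i))"
      by (intro sum_mono prod_mono) (auto intro!: sum_nonneg h0 hs)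
    also have "\<dots> = card (F ` ?V ys) * (\<Prod>i<n. side_mass Q g (ys ! i))" by simp
    also have "\<dots> \<le> M * (\<Prod>i<n. side_mass Q g (ys ! i))"
      using card[OF ys] by (intro mult_right_mono prod_nonneg) (auto simp: side_mass_nonneg)
    finally show "(\<Sum>v\<in>?V ys. \<Prod>i<n. ?h (v ! i) (F v ! i)) \<le> M * (\<Prod>i<n. side_mass Q g (ys ! i))" .
  qed
  also have "\<dots> = M"
    using sum_seqs_prod[where n = n and h = "\<lambda>_. side_mass Q g"] by (simp add: sum_side_mass flip: sum_distrib_left)
  finally show ?thesis .
qed

text \<open>For the averaged kernel, n I(q) is exactly the mean of the logarithm of a product of
  information ratios. The tangent of the logarithm at \<open>M\<close> plays the part of Jensen's
  inequality, and the union bound controls the mean of the product. The identity for all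
  \<open>f\<close> transfers the distortions of the code to the kernel without loss.\<close>

lemma code_rate_ge_cmi:
  fixes Q :: "'a::finite pmf" and g :: "'a \<Rightarrow> 'y::finite" and F :: "'a list \<Rightarrow> 'b::finite list"
  assumes n: "0 < n" and M: "0 < M"
    and F: "\<And>v. v \<in> seqs n \<Longrightarrow> F v \<in> seqs n"
    and card: "\<And>ys. ys \<in> seqs n \<Longrightarrow> real (card (F ` {v \<in> seqs n. map g v = ys})) \<le> M"
  shows "\<exists>q. n * cmi Q g q \<le> log 2 M \<and>
    (\<forall>f :: 'a \<Rightarrow> 'b \<Rightarrow> real. (\<Sum>a\<in>UNIV. \<Sum>b\<in>UNIV. pmf Q a * pmf (q a) b * f a b) =
      (\<Sum>v\<in>seqs n. (\<Prod>i<n. pmf Q (v ! i)) * (1 / n * (\<Sum>i<n. f (v ! i) (F v ! i)))))"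
proof -
  let ?W = "\<lambda>v. \<Prod>i<n. pmf Q (v ! i)"
  have W0: "0 \<le> ?W v" for v by (intro prod_nonneg) auto
  have W1: "(\<Sum>v\<in>seqs n. ?W v) = 1" by (subst sum_seqs_prod) (simp add: sum_pmf_eq_1)
  from ex_average_kernel[OF n, of Q F] obtain q :: "'a \<Rightarrow> 'b pmf"
    where q': "\<forall>f :: 'a \<Rightarrow> 'b \<Rightarrow> real. (\<Sum>a\<in>UNIV. \<Sum>b\<in>UNIV. pmf Q a * pmf (q a) b * f a b) =
      (\<Sum>v\<in>seqs n. ?W v * (1 / n * (\<Sum>i<n. f (v ! i) (F v ! i))))" ..
  note q = q'[rule_format]
  let ?\<rho> = "info_ratio Q g q"
  \<comment> \<open>A letter pair that occurs in a block of positive probability has positive mass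
    under the averaged law, so the logarithms below are genuine.\<close>
  have pos: "0 < ?\<rho> (v ! i) (F v ! i)" if v: "v \<in> seqs n" "0 < ?W v" and i: "i < n" for v i
  proof -
    have Qpos: "0 < pmf Q (v ! i)"
      using v(2) i by (metis finite_lessThan lessThan_iff less_irrefl pmf_pos prod_zero)
    have "0 < ?W v * (1 / n * 1)" using v n by simp
    also have "\<dots> \<le> ?W v * (1 / n * (\<Sum>j<n. of_bool (v ! j = v ! i \<and> F v ! j = F v ! i)))"
      using i member_le_sum[of i "{..<n}" "\<lambda>j. of_bool (v ! j = v ! i \<and> F v ! j = F v ! i) :: real"]
      by (intro mult_left_mono W0) auto
    also have "\<dots> \<le> (\<Sum>v'\<in>seqs n. ?W v' * (1 / n * (\<Sum>j<n. of_bool (v' ! j = v ! i \<and> F v' ! j = F v ! i))))"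
      by (rule member_le_sum[OF v(1)]) (use W0 in auto)
    also have "\<dots> = (\<Sum>a\<in>UNIV. \<Sum>b\<in>UNIV. pmf Q a * pmf (q a) b * of_bool (a = v ! i \<and> b = F v ! i))"
      by (rule q[symmetric])
    also have "\<dots> = (\<Sum>x\<in>UNIV. if x = (v ! i, F v ! i) then pmf Q (v ! i) * pmf (q (v ! i)) (F v ! i) else 0)"
      unfolding sum.cartesian_product by (intro sum.cong) auto
    also have "\<dots> = pmf Q (v ! i) * pmf (q (v ! i)) (F v ! i)" by simp
    finally have "0 < pmf (q (v ! i)) (F v ! i)" using Qpos by (simp add: zero_less_mult_iff)
    then show ?thesis using Qpos by (intro info_ratio_pos)
  qed
  have "n * cmi Q g q * ln 2 = (\<Sum>v\<in>seqs n. ?W v * (\<Sum>i<n. ln (?\<rho> (v ! i) (F v ! i))))"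
  proof -
    have "n * cmi Q g q * ln 2 =
        (\<Sum>v\<in>seqs n. ?W v * (1 / n * (\<Sum>i<n. log 2 (?\<rho> (v ! i) (F v ! i)))) * (n * ln 2))"
      unfolding cmi_def q sum_distrib_right[symmetric] by (simp only: mult_ac)
    also have "\<dots> = (\<Sum>v\<in>seqs n. ?W v * (\<Sum>i<n. ln (?\<rho> (v ! i) (F v ! i))))"
      using n by (intro sum.cong refl) (simp add: log_def flip: sum_divide_distrib)
    finally show ?thesis .
  qed
  also have "\<dots> \<le> (\<Sum>v\<in>seqs n. (\<Prod>i<n. pmf Q (v ! i) * ?\<rho> (v ! i) (F v ! i)) / M + ?W v * (ln M - 1))"
  proof (intro sum_mono)
    fix v :: "'a list" assume v: "v \<in> seqs n"
    show "?W v * (\<Sum>i<n. ln (?\<rho> (v ! i) (F v ! i))) \<le>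
        (\<Prod>i<n. pmf Q (v ! i) * ?\<rho> (v ! i) (F v ! i)) / M + ?W v * (ln M - 1)"
    proof (cases "?W v = 0")
      case True
      then show ?thesis unfolding prod.distrib True by simp
    next
      case False
      then have Wp: "0 < ?W v" using W0[of v] by linarith
      let ?Z = "\<Prod>i<n. ?\<rho> (v ! i) (F v ! i)"
      have Z: "0 < ?Z" by (intro prod_pos) (use pos[OF v Wp] in auto)
      have "(\<Sum>i<n. ln (?\<rho> (v ! i) (F v ! i))) = ln ?Z"
        by (rule ln_prod[symmetric]) (use pos[OF v Wp] in \<open>auto simp: less_imp_neq[symmetric]\<close>)
      also have "\<dots> = ln (?Z / M) + ln M" using ln_divide_pos[OF Z M] by simp
      \<comment> \<open>The tangent of ln at \<open>M\<close>, evaluated at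
        \<open>?Z\<close>.\<close>
      also have "\<dots> \<le> ?Z / M - 1 + ln M" using ln_le_minus_one[OF divide_pos_pos[OF Z M]] by simp
      finally have "?W v * (\<Sum>i<n. ln (?\<rho> (v ! i) (F v ! i))) \<le> ?W v * (?Z / M - 1 + ln M)"
        by (rule mult_left_mono[OF _ W0])
      also have "\<dots> = (\<Prod>i<n. pmf Q (v ! i) * ?\<rho> (v ! i) (F v ! i)) / M + ?W v * (ln M - 1)"
        by (simp add: prod.distrib algebra_simps)
      finally show ?thesis .
    qed
  qed
  also have "\<dots> = (\<Sum>v\<in>seqs n. \<Prod>i<n. pmf Q (v ! i) * ?\<rho> (v ! i) (F v ! i)) / M + (ln M - 1)"
    by (simp add: sum.distrib W1 flip: sum_divide_distrib sum_distrib_right)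
  also have "\<dots> \<le> 1 + (ln M - 1)"
    using sum_info_ratio_le[of n F g M Q q, OF F card] M by (intro add_right_mono) (auto simp: divide_le_eq)
  finally have "n * cmi Q g q \<le> log 2 M" by (simp add: log_def le_divide_eq)
  then show ?thesis using q' by blast
qed

section \<open>Typical sequences and codebooks\<close>

lemma sum_side_out: "(\<Sum>b\<in>UNIV. side_out Q g q y (b :: 'b::finite)) = side_mass Q g y"
  unfolding side_out_def side_mass_def
  by (subst sum.swap) (simp add: sum_pmf_eq_1 flip: sum_distrib_left)

text \<open>Here \<open>r\<close> is the conditional law of the output given the side information
  alone, from which codewords can be drawn without knowing the source block. The factorization is
  the change of measure from \<open>r\<close> to \<open>q\<close>.\<close>

lemma ex_output_kernel:
  fixes Q :: "'a::finite pmf" and q :: "'a \<Rightarrow> 'b::finite pmf"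
  shows "\<exists>r :: 'y \<Rightarrow> 'b \<Rightarrow> real. (\<forall>y b. 0 \<le> r y b) \<and> (\<forall>y. (\<Sum>b\<in>UNIV. r y b) = 1) \<and>
    (\<forall>a b. 0 < pmf Q a \<longrightarrow> 0 < pmf (q a) b \<longrightarrow> pmf (q a) b = r (g a) b * info_ratio Q g q a b)"
proof -
  \<comment> \<open>Where p(y) = 0 the uniform law is a default that keeps \<open>r y\<close> a pmf
    for every \<open>y\<close>.\<close>
  let ?r = "\<lambda>y b. if side_mass Q g y = 0 then 1 / CARD('b) else side_out Q g q y b / side_mass Q g y"
  have "0 \<le> ?r y b" for y b by (auto simp: side_out_nonneg side_mass_nonneg)
  moreover have "(\<Sum>b\<in>UNIV. ?r y b) = 1" for y
    by (cases "side_mass Q g y = 0") (auto simp: sum_side_out simp flip: sum_divide_distrib)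
  moreover have "pmf (q a) b = ?r (g a) b * info_ratio Q g q a b" if "0 < pmf Q a" "0 < pmf (q a) b" for a b
  proof -
    have "0 < side_mass Q g (g a)" "0 < side_out Q g q (g a) b"
      using that side_mass_ge[of Q a g] side_out_ge[of Q a q b g] mult_pos_pos[OF that] by linarith+
    then show ?thesis by (simp add: info_ratio_def)
  qed
  ultimately show ?thesis by (intro exI[of _ ?r]) blast
qed

definition joint_mean :: "'a::finite pmf \<Rightarrow> ('a \<Rightarrow> 'b::finite pmf) \<Rightarrow> ('a \<Rightarrow> 'b \<Rightarrow> real) \<Rightarrow> real" where
  "joint_mean Q q f = (\<Sum>a\<in>UNIV. \<Sum>b\<in>UNIV. pmf Q a * pmf (q a) b * f a b)"

definition joint_var :: "'a::finite pmf \<Rightarrow> ('a \<Rightarrow> 'b::finite pmf) \<Rightarrow> ('a \<Rightarrow> 'b \<Rightarrow> real) \<Rightarrow> real" where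
  "joint_var Q q f = joint_mean Q q (\<lambda>a b. (f a b - joint_mean Q q f)\<^sup>2)"

lemma joint_mean_const: "joint_mean Q q (\<lambda>_ _. c) = c"
  unfolding joint_mean_def by (simp add: sum_pmf_eq_1 flip: sum_distrib_left sum_distrib_right)

lemma joint_mean_one:
  fixes Q :: "'a::finite pmf" and q :: "'a \<Rightarrow> 'b::finite pmf"
  shows "(\<Sum>a\<in>UNIV. \<Sum>b\<in>UNIV. pmf Q a * pmf (q a) b) = 1"
  using joint_mean_const[of Q q 1] by (simp add: joint_mean_def)

text \<open>Typicality is required only for the finitely many test functions in \<open>H\<close>,
  not for the empirical type. In use \<open>H\<close> holds the distortions and the log information
  ratio, so one set controls both the distortions and the rate.\<close>

definition typical :: "'a::finite pmf \<Rightarrow> ('a \<Rightarrow> 'b::finite pmf) \<Rightarrow> ('a \<Rightarrow> 'b \<Rightarrow> real) set \<Rightarrow> nat \<Rightarrow> real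
    \<Rightarrow> 'a list \<Rightarrow> 'b list set" where
  "typical Q q H n \<delta> v =
    {u. \<forall>f\<in>H. \<bar>(\<Sum>i<n. f (v ! i) (u ! i)) - n * joint_mean Q q f\<bar> \<le> n * \<delta>}"

text \<open>A union bound over \<open>H\<close> followed by Chebyshev's inequality for each test
  function.\<close>

lemma atypical_prob:
  fixes Q :: "'a::finite pmf" and q :: "'a \<Rightarrow> 'b::finite pmf"
  assumes H: "finite H" and n: "0 < n" and \<delta>: "0 < \<delta>"
  shows "(\<Sum>v\<in>seqs n. \<Sum>u\<in>seqs n. (\<Prod>i<n. pmf Q (v ! i) * pmf (q (v ! i)) (u ! i)) *
      of_bool (u \<notin> typical Q q H n \<delta> v)) \<le> (\<Sum>f\<in>H. joint_var Q q f) / (n * \<delta>\<^sup>2)"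
proof -
  let ?J = "\<lambda>v u. \<Prod>i<n. pmf Q (v ! i) * pmf (q (v ! i)) (u ! i)"
  let ?D = "\<lambda>f v u. real n * \<delta> < \<bar>(\<Sum>i<n. f (v ! i) (u ! i)) - n * joint_mean Q q f\<bar>"
  have J0: "0 \<le> ?J v u" for v u by (intro prod_nonneg) auto
  have "(\<Sum>v\<in>seqs n. \<Sum>u\<in>seqs n. ?J v u * of_bool (u \<notin> typical Q q H n \<delta> v)) \<le>
      (\<Sum>v\<in>seqs n. \<Sum>u\<in>seqs n. \<Sum>f\<in>H. ?J v u * of_bool (?D f v u))"
    unfolding sum_distrib_left[symmetric]
  proof (intro sum_mono mult_left_mono J0)
    fix v u
    show "of_bool (u \<notin> typical Q q H n \<delta> v) \<le> (\<Sum>f\<in>H. of_bool (?D f v u) :: real)"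
    proof (cases "u \<in> typical Q q H n \<delta> v")
      case False
      then obtain f where f: "f \<in> H" "?D f v u" by (auto simp: typical_def not_le)
      have "(1::real) = of_bool (?D f v u)" using f by simp
      also have "\<dots> \<le> (\<Sum>f\<in>H. of_bool (?D f v u))" by (rule member_le_sum) (use f H in auto)
      finally show ?thesis using False by simp
    qed (simp add: sum_nonneg del: sum_of_bool_eq)
  qed
  also have "\<dots> = (\<Sum>f\<in>H. \<Sum>v\<in>seqs n. \<Sum>u\<in>seqs n. ?J v u * of_bool (?D f v u))"
    by (subst (2) sum.swap, subst sum.swap) (rule refl)
  also have "\<dots> \<le> (\<Sum>f\<in>H. joint_var Q q f / (n * \<delta>\<^sup>2))"
    unfolding joint_var_def joint_mean_def[of Q q "\<lambda>a b. (_ a b - _)\<^sup>2"]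
    by (intro sum_mono chebyshev_seqs joint_mean_one n \<delta>) (auto simp: joint_mean_def)
  finally show ?thesis by (simp add: sum_divide_distrib)
qed

text \<open>The probability of the word under \<open>q\<close> is its probability under
  \<open>r\<close> times the product of the information ratios, and typicality bounds that product
  by 2 to the power n (I + \<delta>). Words of probability 0 under \<open>q\<close> are separated
  first, since there the logarithm does not recover the ratio.\<close>

lemma output_prob_ge:
  fixes Q :: "'a::finite pmf" and q :: "'a \<Rightarrow> 'b::finite pmf"
  assumes r0: "\<And>y b. 0 \<le> r y b"
    and r: "\<And>a b. 0 < pmf Q a \<Longrightarrow> 0 < pmf (q a) b \<Longrightarrow> pmf (q a) b = r (g a) b * info_ratio Q g q a b"
    and v: "v \<in> seqs n" "\<And>i. i < n \<Longrightarrow> 0 < pmf Q (v ! i)"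
    and H: "(\<lambda>a b. log 2 (info_ratio Q g q a b)) \<in> H"
    and u: "u \<in> typical Q q H n \<delta> v"
  shows "2 powr (- (n * (cmi Q g q + \<delta>))) * (\<Prod>i<n. pmf (q (v ! i)) (u ! i)) \<le>
    (\<Prod>i<n. r (map g v ! i) (u ! i))"
proof (cases "\<exists>i<n. pmf (q (v ! i)) (u ! i) = 0")
  case True
  then have z: "(\<Prod>i<n. pmf (q (v ! i)) (u ! i)) = 0" by (intro prod_zero) auto
  show ?thesis unfolding z by (simp add: prod_nonneg r0)
next
  case False
  then have qp: "0 < pmf (q (v ! i)) (u ! i)" if "i < n" for i using that by (simp add: pmf_pos)
  let ?\<rho> = "\<lambda>i. info_ratio Q g q (v ! i) (u ! i)"
  let ?r = "\<Prod>i<n. r (map g v ! i) (u ! i)"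
  have \<rho>: "0 < ?\<rho> i" if "i < n" for i by (rule info_ratio_pos) (use v qp that in auto)
  have len: "length v = n" using v by (simp add: seqs_def)
  have "(\<Sum>i<n. log 2 (?\<rho> i)) \<le> n * (cmi Q g q + \<delta>)"
  proof -
    let ?f = "\<lambda>a b. log 2 (info_ratio Q g q a b)"
    have "\<bar>(\<Sum>i<n. ?f (v ! i) (u ! i)) - n * joint_mean Q q ?f\<bar> \<le> n * \<delta>"
      by (rule u[unfolded typical_def mem_Collect_eq, rule_format, OF H])
    moreover have "joint_mean Q q ?f = cmi Q g q" by (simp add: joint_mean_def cmi_def)
    ultimately show ?thesis by (simp add: distrib_left)
  qed
  then have "(\<Prod>i<n. ?\<rho> i) \<le> 2 powr (n * (cmi Q g q + \<delta>))"
  proof -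
    have "(\<Prod>i<n. ?\<rho> i) = (\<Prod>i<n. 2 powr log 2 (?\<rho> i))" using \<rho> by (intro prod.cong) auto
    also have "\<dots> = 2 powr (\<Sum>i<n. log 2 (?\<rho> i))" by (subst powr_sum) auto
    also assume "(\<Sum>i<n. log 2 (?\<rho> i)) \<le> n * (cmi Q g q + \<delta>)"
    finally show ?thesis by simp
  qed
  moreover have "(\<Prod>i<n. pmf (q (v ! i)) (u ! i)) = ?r * (\<Prod>i<n. ?\<rho> i)"
    unfolding prod.distrib[symmetric] using v qp len by (intro prod.cong refl) (auto intro: r)
  ultimately have "(\<Prod>i<n. pmf (q (v ! i)) (u ! i)) \<le> ?r * 2 powr (n * (cmi Q g q + \<delta>))"
    by (simp add: mult_left_mono prod_nonneg r0)
  then show ?thesis by (subst powr_minus) (simp add: inverse_eq_divide divide_le_eq)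
qed

text \<open>A greedy codebook is chosen for each \<open>ys\<close> separately, on the blocks
  compatible with it. The covering inequality then splits the uncovered probability into the
  probability of atypical pairs and a term that decays once \<open>M\<close> exceeds the
  exponent.\<close>

lemma ex_codebook:
  fixes Q :: "'a::finite pmf" and q :: "'a \<Rightarrow> 'b::finite pmf" and g :: "'a \<Rightarrow> 'y::finite"
  assumes H: "finite H" "(\<lambda>a b. log 2 (info_ratio Q g q a b)) \<in> H" and n: "0 < n" and \<delta>: "0 < \<delta>"
  shows "\<exists>c :: 'y list \<Rightarrow> nat \<Rightarrow> 'b list. (\<forall>ys m. c ys m \<in> seqs n) \<and>
    (\<Sum>v | v \<in> seqs n \<and> (\<forall>m<M. c (map g v) m \<notin> typical Q q H n \<delta> v). \<Prod>i<n. pmf Q (v ! i)) \<le>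
    (\<Sum>f\<in>H. joint_var Q q f) / (n * \<delta>\<^sup>2) + exp (- (real M * 2 powr (- (n * (cmi Q g q + \<delta>)))))"
proof -
  obtain r :: "'y \<Rightarrow> 'b \<Rightarrow> real" where r0: "\<And>y b. 0 \<le> r y b" and r1: "\<And>y. (\<Sum>b\<in>UNIV. r y b) = 1"
    and r: "\<And>a b. 0 < pmf Q a \<Longrightarrow> 0 < pmf (q a) b \<Longrightarrow> pmf (q a) b = r (g a) b * info_ratio Q g q a b"
    using ex_output_kernel[of Q q g] by blast
  let ?W = "\<lambda>v. \<Prod>i<n. pmf Q (v ! i)"
  let ?K = "\<lambda>v u. \<Prod>i<n. pmf (q (v ! i)) (u ! i)"
  let ?R = "\<lambda>ys u. \<Prod>i<n. r (ys ! i) (u ! i)"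
  let ?T = "typical Q q H n \<delta>"
  let ?y = "2 powr (- (n * (cmi Q g q + \<delta>)))"
  let ?\<epsilon> = "exp (- (real M * ?y))"
  have W0: "0 \<le> ?W v" and K0: "0 \<le> ?K v u" and R0: "0 \<le> ?R ys u" for v u ys
    by (auto intro!: prod_nonneg r0)
  have W1: "(\<Sum>v\<in>seqs n. ?W v) = 1" by (subst sum_seqs_prod) (simp add: sum_pmf_eq_1)
  have K1: "(\<Sum>u\<in>seqs n. ?K v u) = 1" for v by (subst sum_seqs_prod) (simp add: sum_pmf_eq_1)
  have R1: "(\<Sum>u\<in>seqs n. ?R ys u) = 1" for ys by (subst sum_seqs_prod) (simp add: r1)
  have "\<forall>ys. \<exists>c :: nat \<Rightarrow> 'b list. (\<forall>m. c m \<in> seqs n) \<and>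
    (\<Sum>v | v \<in> {v \<in> seqs n. map g v = ys} \<and> (\<forall>m<M. c m \<notin> ?T v). ?W v) \<le>
    (\<Sum>v\<in>{v \<in> seqs n. map g v = ys}. ?W v * (1 - sum (?R ys) (seqs n \<inter> ?T v)) ^ M)"
    by (intro allI greedy_codebook) (auto simp: R0 R1)
  from choice[OF this] obtain c where c': "\<forall>ys. (\<forall>m. c ys m \<in> seqs n) \<and>
    (\<Sum>v | v \<in> {v \<in> seqs n. map g v = ys} \<and> (\<forall>m<M. c ys m \<notin> ?T v). ?W v) \<le>
    (\<Sum>v\<in>{v \<in> seqs n. map g v = ys}. ?W v * (1 - sum (?R ys) (seqs n \<inter> ?T v)) ^ M)" ..
  note c = c'[rule_format, THEN conjunct1, rule_format] c'[rule_format, THEN conjunct2]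
  \<comment> \<open>The covering inequality with r and x the masses of the typical words under
    \<open>?R\<close> and \<open>?K\<close>, and y = \<open>?y\<close>.\<close>
  have bound: "?W v * (1 - sum (?R (map g v)) (seqs n \<inter> ?T v)) ^ M \<le>
      ?W v * ((\<Sum>u\<in>seqs n. ?K v u * of_bool (u \<notin> ?T v)) + ?\<epsilon>)" if v: "v \<in> seqs n" for v
  proof (cases "?W v = 0")
    case False
    then have Qp: "0 < pmf Q (v ! i)" if "i < n" for i
      using that by (metis finite_lessThan lessThan_iff pmf_pos prod_zero)
    have "?y * sum (?K v) (seqs n \<inter> ?T v) \<le> sum (?R (map g v)) (seqs n \<inter> ?T v)"
      unfolding sum_distrib_left by (intro sum_mono output_prob_ge[where H = H] r0 r v Qp H(2)) auto
    moreover have "sum (?R (map g v)) (seqs n \<inter> ?T v) \<le> sum (?R (map g v)) (seqs n)"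
      "sum (?K v) (seqs n \<inter> ?T v) \<le> sum (?K v) (seqs n)"
      by (auto intro!: sum_mono2 R0 K0 simp del: length_map nth_map)
    ultimately have "(1 - sum (?R (map g v)) (seqs n \<inter> ?T v)) ^ M \<le> 1 - sum (?K v) (seqs n \<inter> ?T v) + ?\<epsilon>"
      unfolding K1 R1 by (intro exp_covering_bound sum_nonneg R0 K0)
    also have "1 - sum (?K v) (seqs n \<inter> ?T v) = (\<Sum>u\<in>seqs n. ?K v u * of_bool (u \<notin> ?T v))"
    proof -
      have "sum (?K v) (seqs n \<inter> ?T v) = (\<Sum>u\<in>seqs n. ?K v u * of_bool (u \<in> ?T v))"
        by (rule sum.mono_neutral_cong_left) auto
      moreover have "(\<Sum>u\<in>seqs n. ?K v u * of_bool (u \<in> ?T v)) + (\<Sum>u\<in>seqs n. ?K v u * of_bool (u \<notin> ?T v)) = (\<Sum>u\<in>seqs n. ?K v u)"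
        unfolding sum.distrib[symmetric] by (intro sum.cong) auto
      ultimately show ?thesis using K1[of v] by linarith
    qed
    finally show ?thesis by (rule mult_left_mono) (rule W0)
  next
    case True
    show ?thesis unfolding True by simp
  qed
  \<comment> \<open>Blocks are grouped by side information, so that each codebook's own guarantee
    applies, and regrouped afterwards.\<close>
  have "(\<Sum>v | v \<in> seqs n \<and> (\<forall>m<M. c (map g v) m \<notin> ?T v). ?W v) =
      (\<Sum>ys\<in>seqs n. \<Sum>v | v \<in> {v \<in> seqs n. \<forall>m<M. c (map g v) m \<notin> ?T v} \<and> map g v = ys. ?W v)"
    by (subst sum.group) (simp, simp, auto simp: seqs_def)
  also have "\<dots> = (\<Sum>ys\<in>seqs n. \<Sum>v | v \<in> {v \<in> seqs n. map g v = ys} \<and> (\<forall>m<M. c ys m \<notin> ?T v). ?W v)"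
    by (intro sum.cong refl) auto
  also have "\<dots> \<le> (\<Sum>ys\<in>seqs n. \<Sum>v\<in>{v \<in> seqs n. map g v = ys}. ?W v * (1 - sum (?R ys) (seqs n \<inter> ?T v)) ^ M)"
    by (intro sum_mono c)
  also have "\<dots> = (\<Sum>ys\<in>seqs n. \<Sum>v\<in>{v \<in> seqs n. map g v = ys}. ?W v * (1 - sum (?R (map g v)) (seqs n \<inter> ?T v)) ^ M)"
    by (intro sum.cong refl) auto
  also have "\<dots> = (\<Sum>v\<in>seqs n. ?W v * (1 - sum (?R (map g v)) (seqs n \<inter> ?T v)) ^ M)"
    by (subst sum.group) (simp, simp, auto simp: seqs_def)
  also have "\<dots> \<le> (\<Sum>v\<in>seqs n. ?W v * ((\<Sum>u\<in>seqs n. ?K v u * of_bool (u \<notin> ?T v)) + ?\<epsilon>))"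
    by (intro sum_mono bound)
  also have "\<dots> = (\<Sum>v\<in>seqs n. \<Sum>u\<in>seqs n. (?W v * ?K v u) * of_bool (u \<notin> ?T v)) + ?\<epsilon>"
    unfolding distrib_left sum.distrib sum_distrib_right[symmetric] W1
    by (simp only: sum_distrib_left mult.assoc mult_1)
  also have "\<dots> \<le> (\<Sum>f\<in>H. joint_var Q q f) / (n * \<delta>\<^sup>2) + ?\<epsilon>"
    unfolding prod.distrib[symmetric] by (intro add_right_mono atypical_prob H n \<delta>)
  finally show ?thesis using c(1) by blast
qed

text \<open>A coarse bound on |f|, finite because both alphabets are; what matters is that it does
  not depend on the block length.\<close>

definition abs_total :: "('a::finite \<Rightarrow> 'b::finite \<Rightarrow> real) \<Rightarrow> real" where
  "abs_total f = (\<Sum>a\<in>UNIV. \<Sum>b\<in>UNIV. \<bar>f a b\<bar>)"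

lemma abs_le_abs_total: "\<bar>f a b\<bar> \<le> abs_total f"
proof -
  have "\<bar>f a b\<bar> \<le> (\<Sum>b\<in>UNIV. \<bar>f a b\<bar>)" by (rule member_le_sum) auto
  also have "\<dots> \<le> abs_total f"
    unfolding abs_total_def
    by (rule member_le_sum[where f = "\<lambda>a. \<Sum>b\<in>UNIV. \<bar>f a b\<bar>"]) (auto intro: sum_nonneg)
  finally show ?thesis .
qed

lemma abs_joint_mean_le: "\<bar>joint_mean Q q f\<bar> \<le> abs_total f"
proof -
  have "\<bar>joint_mean Q q f\<bar> \<le> (\<Sum>a\<in>UNIV. \<Sum>b\<in>UNIV. \<bar>pmf Q a * pmf (q a) b * f a b\<bar>)"
    unfolding joint_mean_def by (intro order_trans[OF sum_abs] sum_mono sum_abs)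
  also have "\<dots> \<le> joint_mean Q q (\<lambda>_ _. abs_total f)"
    unfolding joint_mean_def
    by (intro sum_mono) (auto simp: abs_mult intro!: mult_mono abs_le_abs_total)
  finally show ?thesis by (simp add: joint_mean_const)
qed

lemma abs_average_le:
  assumes "0 < n"
  shows "\<bar>1 / n * (\<Sum>i<n. f (v ! i) (u ! i))\<bar> \<le> abs_total f"
proof -
  have "\<bar>\<Sum>i<n. f (v ! i) (u ! i)\<bar> \<le> (\<Sum>i<n. abs_total f)"
    by (intro order_trans[OF sum_abs] sum_mono abs_le_abs_total)
  then show ?thesis using assms by (simp add: abs_mult divide_le_eq mult.commute)
qed

text \<open>On covered blocks typicality keeps every average within \<delta> of its mean; on the
  others the error is at most twice the bound on |f|, weighted by the failure probability.\<close>

lemma ex_code: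
  fixes Q :: "'a::finite pmf" and q :: "'a \<Rightarrow> 'b::finite pmf" and g :: "'a \<Rightarrow> 'y::finite"
  assumes H: "finite H" "(\<lambda>a b. log 2 (info_ratio Q g q a b)) \<in> H"
    and n: "0 < n" and \<delta>: "0 < \<delta>" and M: "0 < M"
  shows "\<exists>(enc :: 'a list \<Rightarrow> nat) (c :: 'y list \<Rightarrow> nat \<Rightarrow> 'b list).
    (\<forall>v. enc v < M) \<and> (\<forall>ys m. c ys m \<in> seqs n) \<and>
    (\<forall>f\<in>H. \<bar>(\<Sum>v\<in>seqs n. (\<Prod>i<n. pmf Q (v ! i)) *
        (1 / n * (\<Sum>i<n. f (v ! i) (c (map g v) (enc v) ! i)))) - joint_mean Q q f\<bar> \<le>
      \<delta> + 2 * abs_total f * ((\<Sum>f\<in>H. joint_var Q q f) / (n * \<delta>\<^sup>2) +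
        exp (- (real M * 2 powr (- (n * (cmi Q g q + \<delta>)))))))"
proof -
  let ?W = "\<lambda>v. \<Prod>i<n. pmf Q (v ! i)"
  let ?T = "typical Q q H n \<delta>"
  let ?p = "(\<Sum>f\<in>H. joint_var Q q f) / (n * \<delta>\<^sup>2) +
        exp (- (real M * 2 powr (- (n * (cmi Q g q + \<delta>)))))"
  have W0: "0 \<le> ?W v" for v by (intro prod_nonneg) auto
  have W1: "(\<Sum>v\<in>seqs n. ?W v) = 1" by (subst sum_seqs_prod) (simp add: sum_pmf_eq_1)
  obtain c :: "'y list \<Rightarrow> nat \<Rightarrow> 'b list" where c: "\<And>ys m. c ys m \<in> seqs n"
    and fail: "(\<Sum>v | v \<in> seqs n \<and> (\<forall>m<M. c (map g v) m \<notin> ?T v). ?W v) \<le> ?p"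
    using ex_codebook[OF H n \<delta>, of M] by blast
  \<comment> \<open>Index 0 is the fallback for uncovered blocks, valid since 0 < M.\<close>
  define enc where "enc v = (if \<exists>m<M. c (map g v) m \<in> ?T v then SOME m. m < M \<and> c (map g v) m \<in> ?T v else 0)" for v
  have enc: "enc v < M" "(\<exists>m<M. c (map g v) m \<in> ?T v) \<Longrightarrow> c (map g v) (enc v) \<in> ?T v" for v
  proof -
    show "enc v < M" "(\<exists>m<M. c (map g v) m \<in> ?T v) \<Longrightarrow> c (map g v) (enc v) \<in> ?T v"
      using someI_ex[of "\<lambda>m. m < M \<and> c (map g v) m \<in> ?T v"] M by (auto simp: enc_def)
  qed
  have "\<bar>(\<Sum>v\<in>seqs n. ?W v * (1 / n * (\<Sum>i<n. f (v ! i) (c (map g v) (enc v) ! i)))) - joint_mean Q q f\<bar> \<le>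
      \<delta> + 2 * abs_total f * ?p" if f: "f \<in> H" for f
  proof -
    let ?B = "abs_total f"
    let ?m = "joint_mean Q q f"
    let ?a = "\<lambda>v. 1 / n * (\<Sum>i<n. f (v ! i) (c (map g v) (enc v) ! i))"
    let ?bad = "\<lambda>v. \<forall>m<M. c (map g v) m \<notin> ?T v"
    have B0: "0 \<le> ?B" using abs_joint_mean_le[of Q q f] by linarith
    have d: "\<bar>?a v - ?m\<bar> \<le> \<delta> + 2 * ?B * of_bool (?bad v)" for v
    proof (cases "?bad v")
      case True
      have "\<bar>?a v - ?m\<bar> \<le> 2 * ?B"
        using abs_joint_mean_le[of Q q f] abs_average_le[OF n, of f v "c (map g v) (enc v)"] by linarith
      then show ?thesis using True \<delta> by simp
    next
      case False
      then have "c (map g v) (enc v) \<in> ?T v" by (intro enc) auto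
      then have "\<bar>(\<Sum>i<n. f (v ! i) (c (map g v) (enc v) ! i)) - n * ?m\<bar> \<le> n * \<delta>"
        unfolding typical_def using f by blast
      also have "(\<Sum>i<n. f (v ! i) (c (map g v) (enc v) ! i)) - n * ?m = n * (?a v - ?m)"
        using n by (simp add: field_simps)
      finally have "\<bar>?a v - ?m\<bar> \<le> \<delta>" using n by (simp add: abs_mult)
      moreover have good: "of_bool (?bad v) = (0 :: real)" using False by simp
      ultimately show ?thesis unfolding good by simp
    qed
    have "(\<Sum>v\<in>seqs n. ?W v * ?a v) - ?m = (\<Sum>v\<in>seqs n. ?W v * (?a v - ?m))"
      unfolding right_diff_distrib sum_subtractf sum_distrib_right[symmetric] W1 by simp
    also have "\<bar>\<dots>\<bar> \<le> (\<Sum>v\<in>seqs n. ?W v * (\<delta> + 2 * ?B * of_bool (?bad v)))"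
      using d W0 by (intro order_trans[OF sum_abs] sum_mono) (simp only: abs_mult abs_of_nonneg mult_left_mono)
    also have "\<dots> = (\<Sum>v\<in>seqs n. ?W v * \<delta> + 2 * ?B * (if ?bad v then ?W v else 0))"
      by (intro sum.cong refl) (simp add: algebra_simps)
    also have "\<dots> = \<delta> + 2 * ?B * (\<Sum>v\<in>seqs n. if ?bad v then ?W v else 0)"
      unfolding sum.distrib sum_distrib_right[symmetric] sum_distrib_left[symmetric] W1 by simp
    also have "(\<Sum>v\<in>seqs n. if ?bad v then ?W v else 0) = (\<Sum>v | v \<in> seqs n \<and> ?bad v. ?W v)"
      by (rule sum.inter_filter[symmetric]) simp
    also have "\<delta> + 2 * ?B * \<dots> \<le> \<delta> + 2 * ?B * ?p"
      using fail B0 by (intro add_left_mono mult_left_mono) auto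
    finally show ?thesis .
  qed
  then show ?thesis using enc(1) c by blast
qed

section \<open>Codes of growing block length\<close>

lemma messages_eq: "messages n R = {1..nat \<lfloor>2 powr (real n * R)\<rfloor>}"
  by (auto simp: messages_def le_nat_iff le_floor_iff)

text \<open>Once the tolerance is below half the gap R - I, the exponent is at least 2 to the power
  n c, minus 1 for the floor, and hence diverges.\<close>

lemma covering_exponent_tendsto:
  fixes I R :: real
  assumes "0 \<le> I" "I < R"
  shows "(\<lambda>n. exp (- (real (nat \<lfloor>2 powr (real n * R)\<rfloor>) *
    2 powr (- (n * (I + real n powr (-1/4))))))) \<longlonglongrightarrow> 0"
proof -
  define c where "c = (R - I) / 2"
  have c: "0 < c" using assms by (simp add: c_def)
  have "(\<lambda>n. real n powr (-1/4)) \<longlonglongrightarrow> 0" by real_asymp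
  then have ev: "\<forall>\<^sub>F n in sequentially. real n powr (-1/4) < c"
    using c by (rule order_tendstoD)
  have "filterlim (\<lambda>n. 2 powr (real n * c) - 1) at_top sequentially"
    using c by real_asymp
  moreover have "\<forall>\<^sub>F n in sequentially. 2 powr (real n * c) - 1 \<le>
      real (nat \<lfloor>2 powr (real n * R)\<rfloor>) * 2 powr (- (n * (I + real n powr (-1/4))))"
    using ev
  proof eventually_elim
    case (elim n)
    let ?s = "2 powr (- (n * (I + c)))"
    have "2 powr (real n * c) - 1 \<le> 2 powr (real n * R) * ?s - 1 * ?s"
    proof -
      have "2 powr (real n * R) * ?s = 2 powr (real n * c)"
        by (simp add: c_def field_simps flip: powr_add)
      moreover have "?s \<le> 2 powr 0" using assms c by (intro powr_mono) auto
      ultimately show ?thesis by simp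
    qed
    also have "\<dots> = (2 powr (real n * R) - 1) * ?s" by (simp add: left_diff_distrib)
    also have "\<dots> \<le> real (nat \<lfloor>2 powr (real n * R)\<rfloor>) * ?s"
      by (intro mult_right_mono) (linarith, simp)
    also have "\<dots> \<le> real (nat \<lfloor>2 powr (real n * R)\<rfloor>) * 2 powr (- (n * (I + real n powr (-1/4))))"
      using elim by (intro mult_left_mono powr_mono) (auto intro!: mult_left_mono)
    finally show ?case .
  qed
  ultimately have "filterlim (\<lambda>n. real (nat \<lfloor>2 powr (real n * R)\<rfloor>) * 2 powr (- (n * (I + real n powr (-1/4))))) at_top sequentially"
    by (rule filterlim_at_top_mono)
  then show ?thesis
    by (intro filterlim_compose[OF exp_at_bot] filterlim_compose[OF filterlim_uminus_at_bot_at_top])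
qed

text \<open>The averages converge to the means themselves, not merely below a bound in the limit,
  because achievability demands that the limits exist.\<close>

lemma ex_code_sequence:
  fixes Q :: "'a::finite pmf" and q :: "'a \<Rightarrow> 'b::finite pmf" and g :: "'a \<Rightarrow> 'y::finite"
  assumes I: "0 \<le> cmi Q g q" "cmi Q g q < R" and E: "finite E"
  shows "\<exists>(enc :: nat \<Rightarrow> 'a list \<Rightarrow> nat) (c :: nat \<Rightarrow> 'y list \<Rightarrow> nat \<Rightarrow> 'b list).
    (\<forall>n v. enc n v \<in> messages n R) \<and> (\<forall>n ys m. c n ys m \<in> seqs n) \<and>
    (\<forall>f\<in>E. (\<lambda>n. \<Sum>v\<in>seqs n. (\<Prod>i<n. pmf Q (v ! i)) *
        (1 / n * (\<Sum>i<n. f (v ! i) (c n (map g v) (enc n v) ! i)))) \<longlonglongrightarrow> joint_mean Q q f)"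
proof -
  define H where "H = insert (\<lambda>a b. log 2 (info_ratio Q g q a b)) E"
  \<comment> \<open>tends to \<open>0\<close>, but slowly enough for Chebyshev: \<open>n * (\<delta> n)\<^sup>2\<close> diverges\<close>
  define \<delta> where "\<delta> n = real n powr (-1/4)" for n :: nat
  define M where "M n = nat \<lfloor>2 powr (real n * R)\<rfloor>" for n :: nat
  have H: "finite H" "(\<lambda>a b. log 2 (info_ratio Q g q a b)) \<in> H" "E \<subseteq> H"
    using E by (auto simp: H_def)
  have M: "0 < M n" for n
  proof -
    have "(2::real) powr 0 \<le> 2 powr (real n * R)" using I by (intro powr_mono) auto
    then have "1 \<le> \<lfloor>2 powr (real n * R)\<rfloor>" by (simp add: le_floor_iff)
    then show ?thesis by (simp add: M_def)
  qed
  let ?V = "\<Sum>f\<in>H. joint_var Q q f"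
  let ?p = "\<lambda>n. ?V / (n * (\<delta> n)\<^sup>2) + exp (- (real (M n) * 2 powr (- (n * (cmi Q g q + \<delta> n)))))"
  let ?D = "\<lambda>n enc c f. \<Sum>v\<in>seqs n. (\<Prod>i<n. pmf Q (v ! i)) *
        (1 / n * (\<Sum>i<n. f (v ! i) (c (map g v) (enc v) ! i)))"
  have "\<forall>n. \<exists>x :: ('a list \<Rightarrow> nat) \<times> ('y list \<Rightarrow> nat \<Rightarrow> 'b list).
    (\<forall>v. fst x v < M n) \<and> (\<forall>ys m. snd x ys m \<in> seqs n) \<and>
    (0 < n \<longrightarrow> (\<forall>f\<in>H. \<bar>?D n (fst x) (snd x) f - joint_mean Q q f\<bar> \<le> \<delta> n + 2 * abs_total f * ?p n))"
  proof
    fix n :: nat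
    show "\<exists>x :: ('a list \<Rightarrow> nat) \<times> ('y list \<Rightarrow> nat \<Rightarrow> 'b list).
      (\<forall>v. fst x v < M n) \<and> (\<forall>ys m. snd x ys m \<in> seqs n) \<and>
      (0 < n \<longrightarrow> (\<forall>f\<in>H. \<bar>?D n (fst x) (snd x) f - joint_mean Q q f\<bar> \<le> \<delta> n + 2 * abs_total f * ?p n))"
    \<comment> \<open>At n = 0 the tolerance is 0 and \<open>ex_code\<close> does not apply; any
      code will do.\<close>
    proof (cases "n = 0")
      case True
      then show ?thesis using M[of n] by (intro exI[of _ "(\<lambda>_. 0, \<lambda>_ _. [])"]) simp
    next
      case False
      then have n: "0 < n" "0 < \<delta> n" by (auto simp: \<delta>_def)
      from ex_code[OF H(1,2) n M[of n]] obtain enc :: "'a list \<Rightarrow> nat" and c :: "'y list \<Rightarrow> nat \<Rightarrow> 'b list"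
        where "(\<forall>v. enc v < M n) \<and> (\<forall>ys m. c ys m \<in> seqs n) \<and>
          (\<forall>f\<in>H. \<bar>?D n enc c f - joint_mean Q q f\<bar> \<le> \<delta> n + 2 * abs_total f * ?p n)" by (elim exE)
      then show ?thesis by (intro exI[of _ "(enc, c)"]) simp
    qed
  qed
  from choice[OF this] obtain x :: "nat \<Rightarrow> ('a list \<Rightarrow> nat) \<times> ('y list \<Rightarrow> nat \<Rightarrow> 'b list)"
    where x: "\<forall>n. (\<forall>v. fst (x n) v < M n) \<and> (\<forall>ys m. snd (x n) ys m \<in> seqs n) \<and>
    (0 < n \<longrightarrow> (\<forall>f\<in>H. \<bar>?D n (fst (x n)) (snd (x n)) f - joint_mean Q q f\<bar> \<le> \<delta> n + 2 * abs_total f * ?p n))" ..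
  \<comment> \<open>Codewords are numbered from 0, messages from 1.\<close>
  let ?enc = "\<lambda>n v. Suc (fst (x n) v)" and ?c = "\<lambda>n ys m. snd (x n) ys (m - 1)"
  have "?enc n v \<in> messages n R" for n v
    using x by (auto simp: messages_eq M_def[symmetric] Suc_le_eq)
  moreover have "?c n ys m \<in> seqs n" for n ys m using x by blast
  moreover have "(\<lambda>n. ?D n (?enc n) (?c n) f) \<longlonglongrightarrow> joint_mean Q q f" if f: "f \<in> E" for f
  proof -
    have "\<delta> \<longlonglongrightarrow> 0" unfolding \<delta>_def[abs_def] by real_asymp
    moreover have "(\<lambda>n. ?V / (n * (\<delta> n)\<^sup>2)) \<longlonglongrightarrow> 0"
    proof -
      have "(\<lambda>n. 1 / (real n * (real n powr (-1/4))\<^sup>2)) \<longlonglongrightarrow> 0" by real_asymp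
      from tendsto_mult_right_zero[OF this, of ?V] show ?thesis by (simp add: \<delta>_def)
    qed
    moreover have "(\<lambda>n. exp (- (real (M n) * 2 powr (- (n * (cmi Q g q + \<delta> n)))))) \<longlonglongrightarrow> 0"
      unfolding M_def \<delta>_def by (rule covering_exponent_tendsto[OF I])
    ultimately have "(\<lambda>n. \<delta> n + 2 * abs_total f * ?p n) \<longlonglongrightarrow> 0 + 2 * abs_total f * (0 + 0)"
      by (intro tendsto_intros)
    then have lim: "(\<lambda>n. \<delta> n + 2 * abs_total f * ?p n) \<longlonglongrightarrow> 0" by simp
    have "(\<lambda>n. ?D n (?enc n) (?c n) f - joint_mean Q q f) \<longlonglongrightarrow> 0"
    proof (rule Lim_null_comparison[OF _ lim])
      show "\<forall>\<^sub>F n in sequentially. norm (?D n (?enc n) (?c n) f - joint_mean Q q f) \<le> \<delta> n + 2 * abs_total f * ?p n"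
        using eventually_gt_at_top[of 0]
      proof eventually_elim
        case (elim n)
        then show ?case using x f H(3) by auto
      qed
    qed
    then show ?thesis by (simp add: LIM_zero_iff)
  qed
  ultimately show ?thesis by (intro exI[of _ ?enc] exI[of _ ?c]) blast
qed

section \<open>Continuity and compactness\<close>

text \<open>The point is l = 0: t ln t tends to 0 from the right, which matches the value 0 at
  0.\<close>

lemma tendsto_x_ln_x:
  fixes x :: "nat \<Rightarrow> real"
  assumes x: "x \<longlonglongrightarrow> l" and nonneg: "\<And>n. 0 \<le> x n"
  shows "(\<lambda>n. x n * ln (x n)) \<longlonglongrightarrow> l * ln l"
proof (cases "l = 0")
  case True
  have "((\<lambda>t. t * ln t) \<longlongrightarrow> 0) (at_right (0::real))" by real_asymp
  then have "continuous (at 0 within {0..}) (\<lambda>t::real. t * ln t)"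
    by (simp add: continuous_within at_within_Ici_at_right)
  then show ?thesis
    unfolding True by (rule continuous_within_tendsto_compose') (use x nonneg True in auto)
next
  case False
  then show ?thesis by (intro tendsto_intros x) auto
qed

text \<open>The logarithm of the ratio is not continuous where probabilities vanish. Splitting it
  leaves only terms of the form t ln t and a term linear in the kernel, all of them continuous up to
  the boundary.\<close>

lemma cmi_entropy_form:
  fixes Q :: "'a::finite pmf" and q :: "'a \<Rightarrow> 'b::finite pmf" and g :: "'a \<Rightarrow> 'y::finite"
  shows "cmi Q g q * ln 2 =
    (\<Sum>a\<in>UNIV. \<Sum>b\<in>UNIV. pmf Q a * (pmf (q a) b * ln (pmf (q a) b))) +
    (\<Sum>a\<in>UNIV. \<Sum>b\<in>UNIV. pmf Q a * pmf (q a) b * ln (side_mass Q g (g a))) -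
    (\<Sum>b\<in>UNIV. \<Sum>y\<in>UNIV. side_out Q g q y b * ln (side_out Q g q y b))"
proof -
  have "cmi Q g q * ln 2 = (\<Sum>a\<in>UNIV. \<Sum>b\<in>UNIV. pmf Q a * pmf (q a) b * ln (info_ratio Q g q a b))"
    unfolding cmi_def sum_distrib_right by (simp add: log_def)
  also have "\<dots> = (\<Sum>a\<in>UNIV. \<Sum>b\<in>UNIV. pmf Q a * (pmf (q a) b * ln (pmf (q a) b)) +
      pmf Q a * pmf (q a) b * ln (side_mass Q g (g a)) -
      pmf Q a * pmf (q a) b * ln (side_out Q g q (g a) b))"
  proof (intro sum.cong refl)
    fix a b
    show "pmf Q a * pmf (q a) b * ln (info_ratio Q g q a b) =
      pmf Q a * (pmf (q a) b * ln (pmf (q a) b)) + pmf Q a * pmf (q a) b * ln (side_mass Q g (g a)) -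
      pmf Q a * pmf (q a) b * ln (side_out Q g q (g a) b)"
    proof (cases "pmf Q a = 0 \<or> pmf (q a) b = 0")
      case False
      then have p: "0 < pmf Q a" "0 < pmf (q a) b" by (auto simp: pmf_pos)
      then have "0 < side_mass Q g (g a)" "0 < side_out Q g q (g a) b"
        using side_mass_ge[of Q a g] side_out_ge[of Q a q b g] mult_pos_pos[OF p] by linarith+
      with p have eq: "ln (info_ratio Q g q a b) =
          ln (pmf (q a) b) + ln (side_mass Q g (g a)) - ln (side_out Q g q (g a) b)"
        unfolding info_ratio_def by (simp add: ln_divide_pos ln_mult_pos)
      show ?thesis unfolding eq by (simp add: algebra_simps)
    qed auto
  qed
  also have "(\<Sum>a\<in>UNIV. \<Sum>b\<in>UNIV. pmf Q a * (pmf (q a) b * ln (pmf (q a) b)) +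
      pmf Q a * pmf (q a) b * ln (side_mass Q g (g a)) -
      pmf Q a * pmf (q a) b * ln (side_out Q g q (g a) b)) =
    (\<Sum>a\<in>UNIV. \<Sum>b\<in>UNIV. pmf Q a * (pmf (q a) b * ln (pmf (q a) b))) +
    (\<Sum>a\<in>UNIV. \<Sum>b\<in>UNIV. pmf Q a * pmf (q a) b * ln (side_mass Q g (g a))) -
    (\<Sum>a\<in>UNIV. \<Sum>b\<in>UNIV. pmf Q a * pmf (q a) b * ln (side_out Q g q (g a) b))"
    unfolding sum_subtractf sum.distrib ..
  also have "(\<Sum>a\<in>UNIV. \<Sum>b\<in>UNIV. pmf Q a * pmf (q a) b * ln (side_out Q g q (g a) b)) =
      (\<Sum>b\<in>UNIV. \<Sum>a\<in>UNIV. pmf Q a * pmf (q a) b * ln (side_out Q g q (g a) b))"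
    by (rule sum.swap)
  also have "\<dots> = (\<Sum>b\<in>UNIV. \<Sum>y\<in>UNIV. side_out Q g q y b * ln (side_out Q g q y b))"
  proof (intro sum.cong refl)
    fix b
    have "(\<Sum>a\<in>UNIV. pmf Q a * pmf (q a) b * ln (side_out Q g q (g a) b)) =
        (\<Sum>y\<in>UNIV. \<Sum>a | a \<in> UNIV \<and> g a = y. pmf Q a * pmf (q a) b * ln (side_out Q g q (g a) b))"
      by (rule sum.group[symmetric]) auto
    also have "\<dots> = (\<Sum>y\<in>UNIV. side_out Q g q y b * ln (side_out Q g q y b))"
      unfolding side_out_def[of Q g q _ b] sum_distrib_right by (intro sum.cong refl) auto
    finally show "(\<Sum>a\<in>UNIV. pmf Q a * pmf (q a) b * ln (side_out Q g q (g a) b)) =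
      (\<Sum>y\<in>UNIV. side_out Q g q y b * ln (side_out Q g q y b))" .
  qed
  finally show ?thesis .
qed

lemma tendsto_cmi:
  fixes qs :: "nat \<Rightarrow> 'a::finite \<Rightarrow> 'b::finite pmf" and g :: "'a \<Rightarrow> 'y::finite"
  assumes lim: "\<And>a b. (\<lambda>n. pmf (qs n a) b) \<longlonglongrightarrow> pmf (q a) b"
  shows "(\<lambda>n. cmi Q g (qs n)) \<longlonglongrightarrow> cmi Q g q"
proof -
  have "(\<lambda>n. side_out Q g (qs n) y b) \<longlonglongrightarrow> side_out Q g q y b" for y b
    unfolding side_out_def by (intro tendsto_intros lim)
  then have "(\<lambda>n. cmi Q g (qs n) * ln 2) \<longlonglongrightarrow> cmi Q g q * ln 2"
    unfolding cmi_entropy_form by (intro tendsto_intros tendsto_x_ln_x lim side_out_nonneg pmf_nonneg)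
  from tendsto_divide[OF this tendsto_const[of "ln 2"]] show ?thesis by simp
qed

text \<open>Kernels are points of a finite-dimensional unit cube, and the conditions defining a pmf
  are closed.\<close>

lemma kernel_convergent_subsequence:
  fixes qs :: "nat \<Rightarrow> 'a::finite \<Rightarrow> 'b::finite pmf"
  shows "\<exists>s q. strict_mono (s :: nat \<Rightarrow> nat) \<and> (\<forall>a b. (\<lambda>n. pmf (qs (s n) a) b) \<longlonglongrightarrow> pmf (q a) b)"
proof -
  define x :: "nat \<Rightarrow> real ^ ('a \<times> 'b)" where "x n = (\<chi> k. pmf (qs n (fst k)) (snd k))" for n
  have "compact (cbox 0 (1 :: real ^ ('a \<times> 'b)))" by (rule compact_cbox)
  moreover have "\<forall>n. x n \<in> cbox 0 1" by (auto simp: mem_box_cart x_def pmf_le_1)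
  ultimately obtain l s where s: "strict_mono s" and l: "(x \<circ> s) \<longlonglongrightarrow> l"
    unfolding compact_def by metis
  have lim: "(\<lambda>n. pmf (qs (s n) a) b) \<longlonglongrightarrow> l $ (a, b)" for a b
    using tendsto_vec_nth[OF l, of "(a, b)"] by (simp add: x_def o_def)
  have "\<exists>m. \<forall>b. pmf m b = l $ (a, b)" for a
  proof (rule ex_pmf_finite)
    show "0 \<le> l $ (a, b)" for b by (rule LIMSEQ_le_const[OF lim]) auto
    have "(\<lambda>n. \<Sum>b\<in>UNIV. pmf (qs (s n) a) b) \<longlonglongrightarrow> (\<Sum>b\<in>UNIV. l $ (a, b))"
      by (intro tendsto_intros lim)
    then show "(\<Sum>b\<in>UNIV. l $ (a, b)) = 1" by (simp add: sum_pmf_eq_1 LIMSEQ_const_iff)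
  qed
  then obtain q where "\<And>a b. pmf (q a) b = l $ (a, b)" by metis
  then show ?thesis using s lim by (intro exI[of _ s] exI[of _ q]) simp
qed

text \<open>Used twice: for the kernels that come from a sequence of codes, and for a minimizing
  sequence of feasible kernels.\<close>

lemma kernel_limit_point:
  fixes qs :: "nat \<Rightarrow> 'a::finite \<Rightarrow> 'b::finite pmf" and g :: "'a \<Rightarrow> 'y::finite"
  shows "\<exists>s q. strict_mono (s :: nat \<Rightarrow> nat) \<and> (\<lambda>n. cmi Q g (qs (s n))) \<longlonglongrightarrow> cmi Q g q \<and>
    (\<forall>f. (\<lambda>n. joint_mean Q (qs (s n)) f) \<longlonglongrightarrow> joint_mean Q q f)"
proof -
  obtain s q where s: "strict_mono (s :: nat \<Rightarrow> nat)"
    and lim: "\<And>a b. (\<lambda>n. pmf (qs (s n) a) b) \<longlonglongrightarrow> pmf (q a) b"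
    using kernel_convergent_subsequence[of qs] by blast
  have "(\<lambda>n. joint_mean Q (qs (s n)) f) \<longlonglongrightarrow> joint_mean Q q f" for f
    unfolding joint_mean_def by (intro tendsto_intros lim)
  then show ?thesis using s tendsto_cmi[of "\<lambda>n. qs (s n)" q, OF lim] by blast
qed

section \<open>The source with a hidden component\<close>

text \<open>Given the visible block \<open>v\<close>, the hidden letters are independent with laws
  \<open>K (v ! j)\<close>; all but the i-th sum to 1. The whole of \<open>v\<close> enters \<phi>
  because reconstructions depend on the whole block.\<close>

lemma sum_source_coordinate:
  fixes P :: "('s::finite \<times> 'a::finite) pmf" and Q :: "'a pmf" and K :: "'a \<Rightarrow> 's pmf"
  assumes P: "\<And>s a. pmf P (s, a) = pmf Q a * pmf (K a) s" and i: "i < n"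
  shows "(\<Sum>w\<in>seqs n. (\<Prod>j<n. pmf P (w ! j)) * \<phi> (fst (w ! i)) (map snd w)) =
    (\<Sum>v\<in>seqs n. (\<Prod>j<n. pmf Q (v ! j)) * (\<Sum>s\<in>UNIV. pmf (K (v ! i)) s * \<phi> s v))"
proof -
  have fib: "(\<Sum>x | snd x = a. f x) = (\<Sum>s\<in>UNIV. f (s, a))" for f :: "'s \<times> 'a \<Rightarrow> real" and a
    by (rule sum.reindex_bij_witness[where i = "\<lambda>s. (s, a)" and j = fst]) auto
  have "(\<Sum>w\<in>seqs n. (\<Prod>j<n. pmf P (w ! j)) * \<phi> (fst (w ! i)) (map snd w)) =
    (\<Sum>v\<in>seqs n. \<Sum>w | w \<in> seqs n \<and> map snd w = v. (\<Prod>j<n. pmf P (w ! j)) * \<phi> (fst (w ! i)) (map snd w))"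
    by (rule sum.group[symmetric]) (simp, simp, auto simp: seqs_def)
  also have "\<dots> = (\<Sum>v\<in>seqs n. (\<Prod>j<n. pmf Q (v ! j)) * (\<Sum>s\<in>UNIV. pmf (K (v ! i)) s * \<phi> s v))"
  proof (intro sum.cong refl)
    fix v :: "'a list" assume v: "v \<in> seqs n"
    let ?h = "\<lambda>j x. pmf P x * (if j = i then \<phi> (fst x) v else 1)"
    have "(\<Sum>w | w \<in> seqs n \<and> map snd w = v. (\<Prod>j<n. pmf P (w ! j)) * \<phi> (fst (w ! i)) (map snd w)) =
      (\<Sum>w | w \<in> seqs n \<and> map snd w = v. \<Prod>j<n. ?h j (w ! j))"
      using i by (intro sum.cong refl) (auto simp: prod.distrib prod.delta)
    also have "\<dots> = (\<Prod>j<n. \<Sum>x | snd x = v ! j. ?h j x)" by (rule sum_seqs_map_prod[OF v])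
    also have "\<dots> = (\<Prod>j<n. pmf Q (v ! j) * (if j = i then \<Sum>s\<in>UNIV. pmf (K (v ! i)) s * \<phi> s v else 1))"
      unfolding fib by (intro prod.cong refl)
        (auto simp: P sum_distrib_left mult_ac sum_pmf_eq_1 simp flip: sum_distrib_left)
    also have "\<dots> = (\<Prod>j<n. pmf Q (v ! j)) * (\<Sum>s\<in>UNIV. pmf (K (v ! i)) s * \<phi> s v)"
      using i by (simp add: prod.distrib prod.delta)
    finally show "(\<Sum>w | w \<in> seqs n \<and> map snd w = v. (\<Prod>j<n. pmf P (w ! j)) * \<phi> (fst (w ! i)) (map snd w)) =
      (\<Prod>j<n. pmf Q (v ! j)) * (\<Sum>s\<in>UNIV. pmf (K (v ! i)) s * \<phi> s v)" .
  qed
  finally show ?thesis .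
qed

lemma expectation_source_block:
  fixes P :: "('s::finite \<times> 'a::finite) pmf" and Q :: "'a pmf" and K :: "'a \<Rightarrow> 's pmf"
  assumes P: "\<And>s a. pmf P (s, a) = pmf Q a * pmf (K a) s"
  shows "measure_pmf.expectation (replicate_pmf n P) (\<lambda>w. 1 / real n * (\<Sum>i<n. \<phi> i (fst (w ! i)) (map snd w))) =
    (\<Sum>v\<in>seqs n. (\<Prod>j<n. pmf Q (v ! j)) * (1 / n * (\<Sum>i<n. \<Sum>s\<in>UNIV. pmf (K (v ! i)) s * \<phi> i s v)))"
proof -
  have "measure_pmf.expectation (replicate_pmf n P) (\<lambda>w. 1 / real n * (\<Sum>i<n. \<phi> i (fst (w ! i)) (map snd w))) =
    (\<Sum>w\<in>seqs n. \<Sum>i<n. 1 / n * ((\<Prod>j<n. pmf P (w ! j)) * \<phi> i (fst (w ! i)) (map snd w)))"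
    by (simp add: expectation_replicate_pmf sum_distrib_left mult_ac)
  also have "\<dots> = (\<Sum>i<n. 1 / n * (\<Sum>w\<in>seqs n. (\<Prod>j<n. pmf P (w ! j)) * \<phi> i (fst (w ! i)) (map snd w)))"
    unfolding sum_distrib_left by (rule sum.swap)
  also have "\<dots> = (\<Sum>i<n. 1 / n * (\<Sum>v\<in>seqs n. (\<Prod>j<n. pmf Q (v ! j)) * (\<Sum>s\<in>UNIV. pmf (K (v ! i)) s * \<phi> i s v)))"
    by (intro sum.cong refl arg_cong2[where f = "(*)"] sum_source_coordinate P) auto
  also have "\<dots> = (\<Sum>v\<in>seqs n. \<Sum>i<n. 1 / n * ((\<Prod>j<n. pmf Q (v ! j)) * (\<Sum>s\<in>UNIV. pmf (K (v ! i)) s * \<phi> i s v)))"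
    unfolding sum_distrib_left[of "1 / n"] by (rule sum.swap)
  also have "\<dots> = (\<Sum>v\<in>seqs n. (\<Prod>j<n. pmf Q (v ! j)) * (1 / n * (\<Sum>i<n. \<Sum>s\<in>UNIV. pmf (K (v ! i)) s * \<phi> i s v)))"
    by (intro sum.cong refl) (simp only: sum_distrib_left[symmetric] mult_ac)
  finally show ?thesis .
qed

text \<open>The three output sequences are zipped into one block of letters, so that a code becomes
  a map between blocks as the converse requires.\<close>

definition decoded_letters ::
  "('x1, 'x2, 'y) encoder \<Rightarrow> ('y, 'h1, 'h2, 'hs) decoder \<Rightarrow> ('x1 \<times> 'x2 \<times> 'y) list
    \<Rightarrow> ('h1 \<times> 'h2 \<times> 'hs) list" where
  "decoded_letters enc dec v =
     (let (h1, h2, hs) = dec (enc (map fst v, map (fst \<circ> snd) v, map (snd \<circ> snd) v), map (snd \<circ> snd) v)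
      in zip h1 (zip h2 hs))"

definition letter_d1 :: "('x1 \<Rightarrow> 'h1 \<Rightarrow> real) \<Rightarrow> 'x1 \<times> 'x2 \<times> 'y \<Rightarrow> 'h1 \<times> 'h2 \<times> 'hs \<Rightarrow> real" where
  "letter_d1 d1 a b = d1 (fst a) (fst b)"

definition letter_d2 :: "('x2 \<Rightarrow> 'h2 \<Rightarrow> real) \<Rightarrow> 'x1 \<times> 'x2 \<times> 'y \<Rightarrow> 'h1 \<times> 'h2 \<times> 'hs \<Rightarrow> real" where
  "letter_d2 d2 a b = d2 (fst (snd a)) (fst (snd b))"

definition letter_ds ::
  "('s::finite \<times> 'x1 \<times> 'x2 \<times> 'y) pmf \<Rightarrow> ('s \<Rightarrow> 'hs \<Rightarrow> real) \<Rightarrow> 'x1 \<times> 'x2 \<times> 'y \<Rightarrow> 'h1 \<times> 'h2 \<times> 'hs \<Rightarrow> real" where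
  "letter_ds P ds a b = modified_ds P ds (fst a) (snd (snd b))"

definition code_mean :: "'a::finite pmf \<Rightarrow> nat \<Rightarrow> ('a list \<Rightarrow> 'b list) \<Rightarrow> ('a \<Rightarrow> 'b \<Rightarrow> real) \<Rightarrow> real" where
  "code_mean Q n F f = (\<Sum>v\<in>seqs n. (\<Prod>i<n. pmf Q (v ! i)) * (1 / n * (\<Sum>i<n. f (v ! i) (F v ! i))))"

lemma feasible_iff:
  fixes P :: "('s::finite \<times> 'x1::finite \<times> 'x2::finite \<times> 'y::finite) pmf"
    and q :: "_ \<Rightarrow> ('h1::finite \<times> 'h2::finite \<times> 'hs::finite) pmf"
  shows "q \<in> feasible P d1 d2 ds D1 D2 Ds \<longleftrightarrow>
    joint_mean (map_pmf snd P) q (letter_d1 d1) \<le> D1 \<and>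
    joint_mean (map_pmf snd P) q (letter_d2 d2) \<le> D2 \<and>
    joint_mean (map_pmf snd P) q (letter_ds P ds) \<le> Ds"
proof -
  have E: "measure_pmf.expectation (joint P q) f = joint_mean (map_pmf snd P) q (\<lambda>a b. f (a, b))" for f
  proof -
    have "measure_pmf.expectation (joint P q) f = (\<Sum>x\<in>UNIV. f x * pmf (joint P q) x)"
      by (rule integral_measure_pmf_real) auto
    also have "\<dots> = joint_mean (map_pmf snd P) q (\<lambda>a b. f (a, b))"
      unfolding joint_mean_def sum.cartesian_product by (intro sum.cong) (auto simp: pmf_joint)
    finally show ?thesis .
  qed
  show ?thesis
    unfolding feasible_def mem_Collect_eq E
    by (simp add: letter_d1_def[abs_def] letter_d2_def[abs_def] letter_ds_def[abs_def] split_beta)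
qed

section \<open>From the four-component source to its visible letters\<close>

locale markov_source =
  fixes P :: "('s::finite \<times> 'x1::finite \<times> 'x2::finite \<times> 'y::finite) pmf"
    and pXY :: "('x1 \<times> 'x2 \<times> 'y) pmf" and pS :: "'x1 \<Rightarrow> 's pmf"
  assumes source: "pmf P (s, x1, x2, y) = pmf pXY (x1, x2, y) * pmf (pS x1) s"
begin

lemma pmf_source: "pmf P (s, a) = pmf pXY a * pmf (pS (fst a)) s"
  by (cases a) (simp add: source)

lemma map_snd_source: "map_pmf snd P = pXY"
proof (rule pmf_eqI)
  fix a
  have "pmf (map_pmf snd P) a = (\<Sum>s\<in>UNIV. pmf P (s, a))"
    unfolding pmf_map_finite
    by (rule sum.reindex_bij_witness[where i = "\<lambda>s. (s, a)" and j = fst]) auto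
  also have "\<dots> = pmf pXY a" by (simp add: pmf_source sum_pmf_eq_1 flip: sum_distrib_left)
  finally show "pmf (map_pmf snd P) a = pmf pXY a" .
qed

lemma map_src_X1: "map_pmf src_X1 P = map_pmf fst pXY"
proof -
  have "map_pmf src_X1 P = map_pmf fst (map_pmf snd P)"
    by (auto simp: pmf.map_comp src_X1_def intro!: map_pmf_cong)
  then show ?thesis by (simp only: map_snd_source)
qed

lemma pmf_src_X1_S:
  "pmf (map_pmf (\<lambda>w. (src_X1 w, src_S w)) P) (x1, s) = pmf (map_pmf src_X1 P) x1 * pmf (pS x1) s"
proof -
  let ?m = "\<Sum>t\<in>UNIV. pmf pXY (x1, t)"
  have "pmf (map_pmf (\<lambda>w. (src_X1 w, src_S w)) P) (x1, s) = (\<Sum>t\<in>UNIV. pmf P (s, x1, t))"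
    unfolding pmf_map_finite
    by (rule sum.reindex_bij_witness[where i = "\<lambda>t. (s, x1, t)" and j = "\<lambda>w. snd (snd w)"])
       (auto simp: src_X1_def src_S_def)
  also have "\<dots> = ?m * pmf (pS x1) s" by (simp add: pmf_source sum_distrib_right)
  also have "?m = pmf (map_pmf src_X1 P) x1"
    unfolding map_src_X1 pmf_map_finite
    by (rule sum.reindex_bij_witness[where i = snd and j = "\<lambda>t. (x1, t)"]) auto
  finally show ?thesis .
qed

text \<open>By the Markov condition p(x1, s) / p(x1) is p(s | x1), so the modified distortion is the
  conditional mean of \<open>ds\<close> given the visible letter. Positive mass of \<open>a\<close>
  excludes the case p(x1) = 0.\<close>

lemma modified_ds_eq:
  assumes "0 < pmf pXY a"
  shows "modified_ds P ds (fst a) sh = (\<Sum>s\<in>UNIV. pmf (pS (fst a)) s * ds s sh)"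
proof -
  have "fst a \<in> set_pmf (map_pmf fst pXY)" using assms by (auto simp: pmf_positive_iff)
  then have "pmf (map_pmf src_X1 P) (fst a) \<noteq> 0" by (simp add: map_src_X1 pmf_eq_0_set_pmf)
  then show ?thesis
    unfolding modified_ds_def pmf_src_X1_S by (simp add: mult.assoc flip: sum_distrib_left)
qed

text \<open>The reconstruction is a function of the visible block, so the hidden letters can be
  averaged out coordinatewise. This turns \<open>ds\<close> into the modified distortion and leaves
  the other two as they are. \<open>is_code\<close> fixes the lengths, without which
  \<open>zip\<close> could lose letters.\<close>

lemma expected_distortions:
  assumes code: "is_code n R enc dec"
  shows "expected_d1 P d1 n enc dec = code_mean pXY n (decoded_letters enc dec) (letter_d1 d1)"
    and "expected_d2 P d2 n enc dec = code_mean pXY n (decoded_letters enc dec) (letter_d2 d2)"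
    and "expected_ds P ds n enc dec = code_mean pXY n (decoded_letters enc dec) (letter_ds P ds)"
proof -
  define rc where "rc v = dec (enc (map fst v, map (fst \<circ> snd) v, map (snd \<circ> snd) v), map (snd \<circ> snd) v)"
    for v :: "('x1 \<times> 'x2 \<times> 'y) list"
  have rec: "reconstruction enc dec w = rc (map snd w)" for w :: "('s \<times> 'x1 \<times> 'x2 \<times> 'y) list"
  proof -
    have "map src_X1 w = map fst (map snd w)" "map src_X2 w = map (fst \<circ> snd) (map snd w)"
      "map src_Y w = map (snd \<circ> snd) (map snd w)"
      by (auto simp: src_X1_def src_X2_def src_Y_def)
    then show ?thesis unfolding reconstruction_def rc_def by (simp only:)
  qed
  have dl: "decoded_letters enc dec v ! i = (fst (rc v) ! i, fst (snd (rc v)) ! i, snd (snd (rc v)) ! i)"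
    if "v \<in> seqs n" "i < n" for v i
  proof -
    have "rc v \<in> seqs n \<times> seqs n \<times> seqs n"
      unfolding rc_def using code that by (auto simp: is_code_def seqs_def Pi_iff)
    then show ?thesis
      using that unfolding decoded_letters_def rc_def[symmetric] by (auto simp: seqs_def split_beta)
  qed
  \<comment> \<open>Agreement is required only at letters of positive mass, since any other letter
    makes the weight of its block 0.\<close>
  have block: "measure_pmf.expectation (replicate_pmf n P)
        (\<lambda>w. 1 / real n * (\<Sum>i<n. \<phi> i (fst (w ! i)) (map snd w))) =
      code_mean pXY n (decoded_letters enc dec) f"
    if "\<And>v i. v \<in> seqs n \<Longrightarrow> i < n \<Longrightarrow> 0 < pmf pXY (v ! i) \<Longrightarrow>
        (\<Sum>s\<in>UNIV. pmf (pS (fst (v ! i))) s * \<phi> i s v) = f (v ! i) (decoded_letters enc dec v ! i)"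
    for \<phi> f
  proof -
    have "measure_pmf.expectation (replicate_pmf n P)
        (\<lambda>w. 1 / real n * (\<Sum>i<n. \<phi> i (fst (w ! i)) (map snd w))) =
      (\<Sum>v\<in>seqs n. (\<Prod>j<n. pmf pXY (v ! j)) * (1 / n * (\<Sum>i<n. \<Sum>s\<in>UNIV. pmf (pS (fst (v ! i))) s * \<phi> i s v)))"
      by (rule expectation_source_block) (rule pmf_source)
    also have "\<dots> = code_mean pXY n (decoded_letters enc dec) f"
      unfolding code_mean_def
    proof (intro sum.cong refl)
      fix v :: "('x1 \<times> 'x2 \<times> 'y) list" assume v: "v \<in> seqs n"
      show "(\<Prod>j<n. pmf pXY (v ! j)) * (1 / n * (\<Sum>i<n. \<Sum>s\<in>UNIV. pmf (pS (fst (v ! i))) s * \<phi> i s v)) =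
        (\<Prod>j<n. pmf pXY (v ! j)) * (1 / n * (\<Sum>i<n. f (v ! i) (decoded_letters enc dec v ! i)))"
      proof (cases "\<forall>i<n. 0 < pmf pXY (v ! i)")
        case True
        then show ?thesis using that[OF v] by simp
      next
        case False
        then have z: "(\<Prod>j<n. pmf pXY (v ! j)) = 0"
          by (intro prod_zero) (auto simp: not_less intro: antisym)
        show ?thesis unfolding z by simp
      qed
    qed
    finally show ?thesis .
  qed
  have E: "measure_pmf.expectation (replicate_pmf n P) h1 = measure_pmf.expectation (replicate_pmf n P) h2"
    if "\<And>w. w \<in> seqs n \<Longrightarrow> h1 w = h2 w" for h1 h2 :: "_ \<Rightarrow> real"
    unfolding expectation_replicate_pmf using that by (intro sum.cong) auto
  \<comment> \<open>The integrands are written as functions of position, hidden letter and visible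
    block, the form that \<open>block\<close> expects.\<close>
  have "expected_d1 P d1 n enc dec = measure_pmf.expectation (replicate_pmf n P)
      (\<lambda>w. 1 / real n * (\<Sum>i<n. (\<lambda>i s v. d1 (fst (v ! i)) (fst (rc v) ! i)) i (fst (w ! i)) (map snd w)))"
    unfolding expected_d1_def
    by (rule E) (auto simp: block_distortion_def rec seqs_def src_X1_def split_beta intro!: sum.cong)
  also have "\<dots> = code_mean pXY n (decoded_letters enc dec) (letter_d1 d1)"
    by (rule block) (simp add: dl letter_d1_def sum_pmf_eq_1 flip: sum_distrib_right)
  finally show "expected_d1 P d1 n enc dec = code_mean pXY n (decoded_letters enc dec) (letter_d1 d1)" .
  have "expected_d2 P d2 n enc dec = measure_pmf.expectation (replicate_pmf n P)
      (\<lambda>w. 1 / real n * (\<Sum>i<n. (\<lambda>i s v. d2 (fst (snd (v ! i))) (fst (snd (rc v)) ! i)) i (fst (w ! i)) (map snd w)))"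
    unfolding expected_d2_def
    by (rule E) (auto simp: block_distortion_def rec seqs_def src_X2_def split_beta intro!: sum.cong)
  also have "\<dots> = code_mean pXY n (decoded_letters enc dec) (letter_d2 d2)"
    by (rule block) (simp add: dl letter_d2_def sum_pmf_eq_1 flip: sum_distrib_right)
  finally show "expected_d2 P d2 n enc dec = code_mean pXY n (decoded_letters enc dec) (letter_d2 d2)" .
  have "expected_ds P ds n enc dec = measure_pmf.expectation (replicate_pmf n P)
      (\<lambda>w. 1 / real n * (\<Sum>i<n. (\<lambda>i s v. ds s (snd (snd (rc v)) ! i)) i (fst (w ! i)) (map snd w)))"
    unfolding expected_ds_def
    by (rule E) (auto simp: block_distortion_def rec seqs_def src_S_def split_beta intro!: sum.cong)
  also have "\<dots> = code_mean pXY n (decoded_letters enc dec) (letter_ds P ds)"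
    by (rule block) (simp add: dl letter_ds_def modified_ds_eq)
  finally show "expected_ds P ds n enc dec = code_mean pXY n (decoded_letters enc dec) (letter_ds P ds)" .
qed

section \<open>Direct part, converse and attainment for the source\<close>

lemma cond_mutual_info_eq:
  fixes q :: "_ \<Rightarrow> ('h1::finite \<times> 'h2::finite \<times> 'hs::finite) pmf"
  shows "cond_mutual_info P q = cmi pXY (snd \<circ> snd) q"
proof -
  have "(\<lambda>(x1, x2, y). y) = snd \<circ> (snd :: 'x1 \<times> 'x2 \<times> 'y \<Rightarrow> _)" by auto
  then show ?thesis using cond_mutual_info_eq_cmi[of P q] by (simp add: map_snd_source)
qed

lemma achievable_of_feasible:
  fixes d1 :: "'x1 \<Rightarrow> 'h1::finite \<Rightarrow> real" and d2 :: "'x2 \<Rightarrow> 'h2::finite \<Rightarrow> real"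
    and ds :: "'s \<Rightarrow> 'hs::finite \<Rightarrow> real"
  assumes nonneg: "\<And>x xh. 0 \<le> d1 x xh" "\<And>x xh. 0 \<le> d2 x xh" "\<And>s sh. 0 \<le> ds s sh"
    and q: "q \<in> feasible P d1 d2 ds D1 D2 Ds" and R: "cond_mutual_info P q < R"
  shows "achievable P d1 d2 ds R D1 D2 Ds"
proof -
  let ?g = "snd \<circ> snd :: 'x1 \<times> 'x2 \<times> 'y \<Rightarrow> 'y"
  let ?E = "{letter_d1 d1, letter_d2 d2, letter_ds P ds} :: ('x1 \<times> 'x2 \<times> 'y \<Rightarrow> 'h1 \<times> 'h2 \<times> 'hs \<Rightarrow> real) set"
  have I: "0 \<le> cmi pXY ?g q" "cmi pXY ?g q < R"
    using cond_mutual_info_nonneg[of P q] R by (simp_all add: cond_mutual_info_eq)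
  have mean: "joint_mean pXY q (letter_d1 d1) \<le> D1" "joint_mean pXY q (letter_d2 d2) \<le> D2"
    "joint_mean pXY q (letter_ds P ds) \<le> Ds"
    using q by (simp_all add: feasible_iff map_snd_source)
  have mean0: "0 \<le> joint_mean pXY q f" if "\<And>a b. 0 \<le> f a b" for f
    unfolding joint_mean_def using that by (intro sum_nonneg mult_nonneg_nonneg) auto
  \<comment> \<open>Achievability includes nonnegative distortion levels; a feasible kernel forces
    them, as its mean distortions are nonnegative.\<close>
  have D: "0 \<le> D1" "0 \<le> D2" "0 \<le> Ds"
  proof -
    show "0 \<le> D1" by (rule order_trans[OF mean0 mean(1)]) (simp add: letter_d1_def nonneg)
    show "0 \<le> D2" by (rule order_trans[OF mean0 mean(2)]) (simp add: letter_d2_def nonneg)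
    show "0 \<le> Ds" by (rule order_trans[OF mean0 mean(3)])
        (simp add: letter_ds_def modified_ds_def nonneg sum_nonneg)
  qed
  obtain enc :: "nat \<Rightarrow> ('x1 \<times> 'x2 \<times> 'y) list \<Rightarrow> nat" and c :: "nat \<Rightarrow> 'y list \<Rightarrow> nat \<Rightarrow> ('h1 \<times> 'h2 \<times> 'hs) list"
    where enc: "\<And>n v. enc n v \<in> messages n R" and c: "\<And>n ys m. c n ys m \<in> seqs n"
    and lim: "\<And>f. f \<in> ?E \<Longrightarrow> (\<lambda>n. code_mean pXY n (\<lambda>v. c n (map ?g v) (enc n v)) f) \<longlonglongrightarrow> joint_mean pXY q f"
    using ex_code_sequence[OF I, of ?E] unfolding code_mean_def by auto
  \<comment> \<open>Codes for abstract letters become codes in the operational sense by zipping the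
    inputs and unzipping the codewords.\<close>
  define e where "e n = (\<lambda>(x1s, x2s, ys). enc n (zip x1s (zip x2s ys)))" for n
  define d where "d n = (\<lambda>(m, ys). (map fst (c n ys m), map (fst \<circ> snd) (c n ys m), map (snd \<circ> snd) (c n ys m)))" for n
  have code: "is_code n R (e n) (d n)" for n
    using enc c by (auto simp: is_code_def e_def d_def seqs_def)
  have zip3: "zip (map fst v) (zip (map (fst \<circ> snd) v) (map (snd \<circ> snd) v)) = v" for v :: "('u \<times> 'v \<times> 'w) list"
    by (induction v) auto
  have dl: "decoded_letters (e n) (d n) = (\<lambda>v. c n (map ?g v) (enc n v))" for n
    by (rule ext) (simp add: decoded_letters_def e_def d_def zip3)
  have "lim_le (\<lambda>n. expected_d1 P d1 n (e n) (d n)) D1"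
    "lim_le (\<lambda>n. expected_d2 P d2 n (e n) (d n)) D2"
    "lim_le (\<lambda>n. expected_ds P ds n (e n) (d n)) Ds"
    unfolding lim_le_def expected_distortions[OF code] dl using lim mean by blast+
  moreover have "0 \<le> R" using I by linarith
  ultimately show ?thesis
    unfolding achievable_def using D code by (intro conjI exI[of _ e] exI[of _ d]) auto
qed

text \<open>With the side information fixed, the decoder's output depends on the message
  alone.\<close>

lemma card_decoded_le:
  assumes code: "is_code n R enc dec"
  shows "real (card (decoded_letters enc dec ` {v \<in> seqs n. map (snd \<circ> snd) v = ys})) \<le> 2 powr (real n * R)"
proof -
  let ?h = "\<lambda>m. let (h1, h2, hs) = dec (m, ys) in zip h1 (zip h2 hs)"
  have "decoded_letters enc dec ` {v \<in> seqs n. map (snd \<circ> snd) v = ys} \<subseteq> ?h ` messages n R"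
  proof
    fix u assume "u \<in> decoded_letters enc dec ` {v \<in> seqs n. map (snd \<circ> snd) v = ys}"
    then obtain v where v: "v \<in> seqs n" "map (snd \<circ> snd) v = ys" "u = decoded_letters enc dec v" by blast
    have "enc (map fst v, map (fst \<circ> snd) v, map (snd \<circ> snd) v) \<in> messages n R"
      using code v(1) by (auto simp: is_code_def Pi_iff seqs_def)
    then show "u \<in> ?h ` messages n R" unfolding v(3) decoded_letters_def v(2) by blast
  qed
  then have "card (decoded_letters enc dec ` {v \<in> seqs n. map (snd \<circ> snd) v = ys}) \<le> card (?h ` messages n R)"
    by (rule card_mono[rotated]) (simp add: messages_eq)
  also have "\<dots> \<le> card (messages n R)" by (rule card_image_le) (simp add: messages_eq)
  also have "real \<dots> \<le> 2 powr (real n * R)" by (simp add: messages_eq)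
  finally show ?thesis by simp
qed

text \<open>At every large block length the kernel of the code has information at most R and the
  distortions of the code. Both survive passage to a limit point, so no slack remains.\<close>

lemma feasible_of_achievable:
  fixes d1 :: "'x1 \<Rightarrow> 'h1::finite \<Rightarrow> real" and d2 :: "'x2 \<Rightarrow> 'h2::finite \<Rightarrow> real"
    and ds :: "'s \<Rightarrow> 'hs::finite \<Rightarrow> real"
  assumes "achievable P d1 d2 ds R D1 D2 Ds"
  shows "\<exists>q \<in> feasible P d1 d2 ds D1 D2 Ds. cond_mutual_info P q \<le> R"
proof -
  let ?g = "snd \<circ> snd :: 'x1 \<times> 'x2 \<times> 'y \<Rightarrow> 'y"
  obtain enc :: "nat \<Rightarrow> ('x1, 'x2, 'y) encoder" and dec :: "nat \<Rightarrow> ('y, 'h1, 'h2, 'hs) decoder"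
    where code: "\<forall>\<^sub>F n in sequentially. is_code n R (enc n) (dec n)"
    and lims: "lim_le (\<lambda>n. expected_d1 P d1 n (enc n) (dec n)) D1"
      "lim_le (\<lambda>n. expected_d2 P d2 n (enc n) (dec n)) D2"
      "lim_le (\<lambda>n. expected_ds P ds n (enc n) (dec n)) Ds"
    using assms unfolding achievable_def by auto
  let ?F = "\<lambda>n. decoded_letters (enc n) (dec n)"
  define good where "good n q \<longleftrightarrow> cmi pXY ?g q \<le> R \<and>
    (\<forall>f. joint_mean pXY q f = code_mean pXY n (?F n) f)" for n q
  have ex: "\<forall>\<^sub>F n in sequentially. \<exists>q. good n q"
    using code eventually_gt_at_top[of 0]
  proof eventually_elim
    case (elim n)
    have len: "?F n v \<in> seqs n" if "v \<in> seqs n" for v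
    proof -
      have "dec n (enc n (map fst v, map (fst \<circ> snd) v, map (snd \<circ> snd) v), map (snd \<circ> snd) v)
          \<in> seqs n \<times> seqs n \<times> seqs n"
        using elim(1) that by (auto simp: is_code_def Pi_iff seqs_def)
      then show ?thesis unfolding decoded_letters_def by (auto simp: seqs_def split_beta)
    qed
    have "\<exists>q. n * cmi pXY ?g q \<le> log 2 (2 powr (real n * R)) \<and>
      (\<forall>f :: _ \<Rightarrow> 'h1 \<times> 'h2 \<times> 'hs \<Rightarrow> real. (\<Sum>a\<in>UNIV. \<Sum>b\<in>UNIV. pmf pXY a * pmf (q a) b * f a b) =
      (\<Sum>v\<in>seqs n. (\<Prod>i<n. pmf pXY (v ! i)) * (1 / n * (\<Sum>i<n. f (v ! i) (?F n v ! i)))))"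
      by (rule code_rate_ge_cmi) (use elim len card_decoded_le[OF elim(1)] in auto)
    then show ?case using elim(2) by (simp add: good_def joint_mean_def code_mean_def)
  qed
  \<comment> \<open>The choice is arbitrary at the finitely many \<open>n\<close> without a good
    kernel.\<close>
  define qs where "qs n = (SOME q. good n q)" for n
  have qs: "\<forall>\<^sub>F n in sequentially. good n (qs n)"
    using ex unfolding qs_def by (rule eventually_mono) (erule someI_ex)
  obtain s q where s: "strict_mono s" and cmi: "(\<lambda>n. cmi pXY ?g (qs (s n))) \<longlonglongrightarrow> cmi pXY ?g q"
    and mean: "\<And>f. (\<lambda>n. joint_mean pXY (qs (s n)) f) \<longlonglongrightarrow> joint_mean pXY q f"
    using kernel_limit_point[of pXY ?g qs] by blast
  note sub = filterlim_subseq[OF s]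
  have evs: "\<forall>\<^sub>F n in sequentially. good (s n) (qs (s n)) \<and> is_code (s n) R (enc (s n)) (dec (s n))"
    using eventually_compose_filterlim[OF eventually_conj[OF qs code] sub] .
  have "cmi pXY ?g q \<le> R"
    by (rule tendsto_upperbound[OF cmi]) (use evs in \<open>auto elim: eventually_mono simp: good_def\<close>)
  \<comment> \<open>Along the subsequence the kernel means are the distortions of the codes, so both
    sequences share one limit.\<close>
  moreover have "joint_mean pXY q f \<le> D"
    if "lim_le E D" and E: "\<And>n. is_code n R (enc n) (dec n) \<Longrightarrow> E n = code_mean pXY n (?F n) f" for E D f
  proof -
    obtain l where l: "E \<longlonglongrightarrow> l" "l \<le> D" using \<open>lim_le E D\<close> by (auto simp: lim_le_def)
    have "\<forall>\<^sub>F n in sequentially. joint_mean pXY (qs (s n)) f = E (s n)"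
      using evs by eventually_elim (auto simp: E good_def)
    moreover have "(\<lambda>n. E (s n)) \<longlonglongrightarrow> l" using filterlim_compose[OF l(1) sub] .
    ultimately have "(\<lambda>n. joint_mean pXY (qs (s n)) f) \<longlonglongrightarrow> l"
      by (simp add: filterlim_cong)
    with mean[of f] have "joint_mean pXY q f = l" by (rule LIMSEQ_unique)
    then show ?thesis using l by simp
  qed
  note le = this
  have "q \<in> feasible P d1 d2 ds D1 D2 Ds"
    unfolding feasible_iff map_snd_source
    using le[OF lims(1)] le[OF lims(2)] le[OF lims(3)] expected_distortions by metis
  ultimately show ?thesis by (auto simp: cond_mutual_info_eq)
qed

text \<open>A minimizing sequence has a limit point; the constraints are closed and the information
  is continuous, so the limit attains the infimum.\<close>

lemma feasible_minimum:
  fixes d1 :: "'x1 \<Rightarrow> 'h1::finite \<Rightarrow> real" and d2 :: "'x2 \<Rightarrow> 'h2::finite \<Rightarrow> real"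
    and ds :: "'s \<Rightarrow> 'hs::finite \<Rightarrow> real"
  assumes ne: "feasible P d1 d2 ds D1 D2 Ds \<noteq> {}"
  shows "\<exists>q \<in> feasible P d1 d2 ds D1 D2 Ds. \<forall>q' \<in> feasible P d1 d2 ds D1 D2 Ds.
    cond_mutual_info P q \<le> cond_mutual_info P q'"
proof -
  let ?Fe = "feasible P d1 d2 ds D1 D2 Ds"
  let ?g = "snd \<circ> snd :: 'x1 \<times> 'x2 \<times> 'y \<Rightarrow> 'y"
  let ?m = "INF q\<in>?Fe. cond_mutual_info P q"
  have bdd: "bdd_below (cond_mutual_info P ` ?Fe)"
    by (rule bdd_belowI2[where m = 0]) (rule cond_mutual_info_nonneg)
  have "\<exists>q\<in>?Fe. cond_mutual_info P q < ?m + 1 / real (Suc n)" for n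
    using cINF_less_iff[OF ne bdd, of "?m + 1 / real (Suc n)"] by simp
  then obtain qs where qs: "\<And>n. qs n \<in> ?Fe" "\<And>n. cond_mutual_info P (qs n) < ?m + 1 / real (Suc n)"
    by metis
  obtain s q where s: "strict_mono s" and cmi: "(\<lambda>n. cmi pXY ?g (qs (s n))) \<longlonglongrightarrow> cmi pXY ?g q"
    and mean: "\<And>f. (\<lambda>n. joint_mean pXY (qs (s n)) f) \<longlonglongrightarrow> joint_mean pXY q f"
    using kernel_limit_point[of pXY ?g qs] by blast
  have "q \<in> ?Fe"
    unfolding feasible_iff map_snd_source
    by (intro conjI LIMSEQ_le_const2[OF mean]) (use qs(1) in \<open>auto simp: feasible_iff map_snd_source\<close>)
  moreover have "cmi pXY ?g q \<le> ?m"
  proof (rule LIMSEQ_le[OF cmi])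
    have "(\<lambda>n. ?m + 1 / real (Suc n)) \<longlonglongrightarrow> ?m + 0"
      by (intro tendsto_intros LIMSEQ_Suc lim_1_over_n)
    then show "(\<lambda>n. ?m + 1 / real (Suc (s n))) \<longlonglongrightarrow> ?m"
      using filterlim_compose[OF _ filterlim_subseq[OF s]] by (simp add: o_def)
    show "\<exists>N. \<forall>n\<ge>N. cmi pXY ?g (qs (s n)) \<le> ?m + 1 / real (Suc (s n))"
      using qs(2) by (auto simp: cond_mutual_info_eq intro: less_imp_le)
  qed
  ultimately show ?thesis
    using cINF_lower[OF bdd] by (auto simp: cond_mutual_info_eq intro!: bexI[of _ q] intro: order_trans)
qed

end

theorem theorem1:
  fixes P :: "('s::finite \<times> 'x1::finite \<times> 'x2::finite \<times> 'y::finite) pmf"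
    and pXY :: "('x1 \<times> 'x2 \<times> 'y) pmf"
    and pS :: "'x1 \<Rightarrow> 's pmf"
    and d1 :: "'x1 \<Rightarrow> 'h1::finite \<Rightarrow> real"
    and d2 :: "'x2 \<Rightarrow> 'h2::finite \<Rightarrow> real"
    and ds :: "'s \<Rightarrow> 'hs::finite \<Rightarrow> real"
    and D1 D2 Ds :: real
  assumes source: "\<And>s x1 x2 y. pmf P (s, x1, x2, y) = pmf pXY (x1, x2, y) * pmf (pS x1) s"
    and d1_nonneg: "\<And>x xh. 0 \<le> d1 x xh"
    and d2_nonneg: "\<And>x xh. 0 \<le> d2 x xh"
    and ds_nonneg: "\<And>s sh. 0 \<le> ds s sh"
  shows "rate_distortion P d1 d2 ds D1 D2 Ds =
           (INF q \<in> feasible P d1 d2 ds D1 D2 Ds. ereal (cond_mutual_info P q))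
       \<and> (feasible P d1 d2 ds D1 D2 Ds \<noteq> {} \<longrightarrow>
           (\<exists>q \<in> feasible P d1 d2 ds D1 D2 Ds.
              rate_distortion P d1 d2 ds D1 D2 Ds = ereal (cond_mutual_info P q)))"
proof -
  interpret markov_source P pXY pS by unfold_locales (rule source)
  let ?Fe = "feasible P d1 d2 ds D1 D2 Ds"
  have eq: "rate_distortion P d1 d2 ds D1 D2 Ds = (INF q\<in>?Fe. ereal (cond_mutual_info P q))"
  proof (rule antisym)
    show "rate_distortion P d1 d2 ds D1 D2 Ds \<le> (INF q\<in>?Fe. ereal (cond_mutual_info P q))"
    proof (rule INF_greatest)
      fix q assume q: "q \<in> ?Fe"
      show "rate_distortion P d1 d2 ds D1 D2 Ds \<le> ereal (cond_mutual_info P q)"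
      \<comment> \<open>Codes exist only for rates strictly above the information, hence the margin
        \<epsilon>.\<close>
      proof (rule ereal_le_epsilon2)
        fix \<epsilon> :: real assume "0 < \<epsilon>"
        then have "achievable P d1 d2 ds (cond_mutual_info P q + \<epsilon>) D1 D2 Ds"
          by (intro achievable_of_feasible[OF d1_nonneg d2_nonneg ds_nonneg q]) simp
        then show "rate_distortion P d1 d2 ds D1 D2 Ds \<le> ereal (cond_mutual_info P q) + ereal \<epsilon>"
          unfolding rate_distortion_def by (intro INF_lower2) auto
      qed
    qed
    \<comment> \<open>Without feasible kernels this shows that no rate is achievable, and both
      infima are infinite.\<close>
    show "(INF q\<in>?Fe. ereal (cond_mutual_info P q)) \<le> rate_distortion P d1 d2 ds D1 D2 Ds"
      unfolding rate_distortion_def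
    proof (rule INF_mono)
      fix R assume "R \<in> {R. achievable P d1 d2 ds R D1 D2 Ds}"
      then show "\<exists>q\<in>?Fe. ereal (cond_mutual_info P q) \<le> ereal R"
        using feasible_of_achievable[of d1 d2 ds R D1 D2 Ds] by auto
    qed
  qed
  have "\<exists>q\<in>?Fe. rate_distortion P d1 d2 ds D1 D2 Ds = ereal (cond_mutual_info P q)" if ne: "?Fe \<noteq> {}"
  proof -
    obtain q where q: "q \<in> ?Fe" "\<forall>q'\<in>?Fe. cond_mutual_info P q \<le> cond_mutual_info P q'"
      using feasible_minimum[OF ne] by blast
    then have "(INF q\<in>?Fe. ereal (cond_mutual_info P q)) = ereal (cond_mutual_info P q)"
      by (intro antisym INF_lower INF_greatest) auto
    then show ?thesis using q(1) eq by auto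
  qed
  with eq show ?thesis by blast
qed

end
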